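(* Let $p$ be a positive integer, $W$ a complete adic ring with finitely generated ideal of definition $\mathfrak m_W$, and $R:=W[[q-1]]$ with the $(\mathfrak m_W+(q-1))$-adic topology. For each $k\in\mathbb N$, there exists a unique continuous $W$-linear map $\partial^{\langle k\rangle}_{q^p}:R\to R$ (resp. $\partial^{\langle k\rangle}_{\mathbb{\Delta}}:R\to R$) such that for all $n\in\mathbb N$, $$\partial^{\langle k\rangle}_{q^p}(q^n)=(k)_{q^p}!\binom nk_{q^p}q^{n-k}\qquad\left(\text{resp. }\ \partial^{\langle k\rangle}_{\mathbb{\Delta}}(q^n)=(p)_q^k(k)_{q^p}!\binom nk_{q^p}q^{n-k}\right),$$ and we have for all $n\in\mathbb N$ and $\alpha\in R$, $$\theta_{n,q^p}(\alpha)=\sum_{k=0}^n\partial^{\langle k\rangle}_{q^p}(\alpha)\,\xi^{[k]_{q^p}}\qquad\left(\text{resp. }\ \theta_{n,\mathbb{\Delta}}(\alpha)=\sum_{k=0}^n\partial^{\langle k\rangle}_{\mathbb{\Delta}}(\alpha)\,\omega^{\{k\}_{\mathbb{\Delta}}}\right).$$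
   Context: $(n)_q=1+q+\cdots+q^{n-1}$, $(n)_q!=(n)_q\cdots(1)_q$, $\binom nk_q$ the Gaussian binomial coefficient; the subscript $q^p$ means replacing $q$ by $q^p$. $R\langle\xi\rangle_{q^p}$ is the commutative $R$-algebra free as a module on $(\xi^{[n]_{q^p}})_{n\in\mathbb N}$, with unit $\xi^{[0]_{q^p}}$, $\xi:=\xi^{[1]_{q^p}}$ and $$\xi^{[n_1]_{q^p}}\xi^{[n_2]_{q^p}}=\sum_{0\le i\le\min(n_1,n_2)}q^{\frac{pi(i-1)}2}\binom{n_1+n_2-i}{n_1}_{q^p}\binom{n_1}{i}_{q^p}(q^p-1)^iq^i\,\xi^{[n_1+n_2-i]_{q^p}}.$$ $R\langle\omega\rangle_{\mathbb{\Delta}}$ is the commutative $R$-algebra free as a module on $(\omega^{\{n\}_{\mathbb{\Delta}}})_{n\in\mathbb N}$, with unit $\omega^{\{0\}_{\mathbb{\Delta}}}$, $\omega:=\omega^{\{1\}_{\mathbb{\Delta}}}$ and the same multiplication formula with $(q^p-1)^i$ replaced by $(q-1)^i$. There is an $R$-algebra morphism $R\langle\xi\rangle_{q^p}\to R\langle\omega\rangle_{\mathbb{\Delta}}$, $\xi^{[n]_{q^p}}\mapsto(p)_q^n\omega^{\{n\}_{\mathbb{\Delta}}}$. The ideals $\xi^{[>n]_{q^p}}$ and $\omega^{\{>n\}_{\mathbb{\Delta}}}$ are the free $R$-submodules on the basis elements of index $>n$. The $q^p$-Taylor map of order $n$, $\theta_{n,q^p}:R\to R\langle\xi\rangle_{q^p}/\xi^{[>n]_{q^p}}$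 (resp. the $\mathbb{\Delta}$-Taylor map of order $n$, $\theta_{n,\mathbb{\Delta}}:R\to R\langle\omega\rangle_{\mathbb{\Delta}}/\omega^{\{>n\}_{\mathbb{\Delta}}}$) is the unique continuous morphism of $W$-algebras with $q\mapsto q+\xi$ (resp. $q\mapsto q+(p)_q\omega$). *)

theory Defs
  imports
    "HOL-Algebra.Algebraic_Closure_Type"
    "HOL-Algebra.Ideal_Product"
    "HOL-Algebra.QuotRing"
    "HOL-Analysis.Abstract_Topology"
    "HOL-Computational_Algebra.Formal_Power_Series"
    "HOL-Library.Poly_Mapping"
begin

section \<open>\<open>q\<close>-integers and Gaussian binomial coefficients\<close>

definition qnum :: "'a::comm_ring_1 \<Rightarrow> nat \<Rightarrow> 'a"
  where "qnum q n = (\<Sum>i<n. q ^ i)"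

definition qfact :: "'a::comm_ring_1 \<Rightarrow> nat \<Rightarrow> 'a"
  where "qfact q n = (\<Prod>i=1..n. qnum q i)"

text \<open>The quotient of \<open>q\<close>-factorials is an identity in \<open>\<int>[q]\<close>; over a general ring, where
  \<open>q\<close>-integers need not be regular, the value of that polynomial is given by the \<open>q\<close>-Pascal
  rule. See \<open>qbinom_qfact\<close> below for the comparison.\<close>

fun qbinom :: "'a::comm_ring_1 \<Rightarrow> nat \<Rightarrow> nat \<Rightarrow> 'a"
  where
    "qbinom q n 0 = 1"
  | "qbinom q 0 (Suc k) = 0"
  | "qbinom q (Suc n) (Suc k) = qbinom q n k + q ^ Suc k * qbinom q n (Suc k)"

lemma qfact_Suc: "qfact q (Suc n) = qnum q (Suc n) * qfact q n"
  by (simp add: qfact_def mult.commute)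

lemma qnum_add: "qnum q (m + n) = qnum q m + q ^ m * qnum q n"
  by (induction n) (simp_all add: qnum_def power_add algebra_simps)

lemma qbinom_eq_0: "n < k \<Longrightarrow> qbinom q n k = 0"
  by (induction q n k rule: qbinom.induct) auto

lemma qbinom_self: "qbinom q n n = 1"
  by (induction n) (simp_all add: qbinom_eq_0)

lemma qbinom_qfact:
  "k \<le> n \<Longrightarrow> qbinom q n k * qfact q k * qfact q (n - k) = qfact q n"
proof (induction q n k rule: qbinom.induct)
  case (1 q n)
  show ?case by (simp add: qfact_def)
next
  case (2 q k)
  then show ?case by simp
next
  case (3 q n k)
  show ?case
  proof (cases "k = n")
    case True
    then show ?thesis using qbinom_self[of q "Suc n"] by (simp add: qfact_def)
  next
    case False
    with 3 have lt: "k < n" by simp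
    define a b where "a = qbinom q n k" and "b = qbinom q n (Suc k)"
    have e: "n - k = Suc (n - Suc k)" using lt by simp
    have ih1: "a * qfact q k * qfact q (n - k) = qfact q n"
      and ih2: "b * qfact q (Suc k) * qfact q (n - Suc k) = qfact q n"
      using 3 lt by (simp_all add: a_def b_def)
    have "qbinom q (Suc n) (Suc k) * qfact q (Suc k) * qfact q (Suc n - Suc k)
        = qnum q (Suc k) * (a * qfact q k * qfact q (n - k))
          + q ^ Suc k * (b * qfact q (Suc k) * qfact q (n - k))"
      by (simp add: a_def b_def qfact_Suc algebra_simps)
    also have "b * qfact q (Suc k) * qfact q (n - k)
        = qnum q (n - k) * (b * qfact q (Suc k) * qfact q (n - Suc k))"
      unfolding e qfact_Suc by (simp only: mult_ac)
    finally have "qbinom q (Suc n) (Suc k) * qfact q (Suc k) * qfact q (Suc n - Suc k)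
        = (qnum q (Suc k) + q ^ Suc k * qnum q (n - k)) * qfact q n"
      unfolding ih1 ih2 by (simp add: algebra_simps)
    also have "qnum q (Suc k) + q ^ Suc k * qnum q (n - k) = qnum q (Suc n)"
      using lt qnum_add[of q "Suc k" "n - k"] by simp
    finally show ?thesis by (simp add: qfact_Suc)
  qed
qed


section \<open>Adic topologies\<close>

primrec ideal_power :: "('a, 'b) ring_scheme \<Rightarrow> 'a set \<Rightarrow> nat \<Rightarrow> 'a set"
  where
    "ideal_power A I 0 = carrier A"
  | "ideal_power A I (Suc n) = ideal_prod A (ideal_power A I n) I"

definition adic_topology :: "('a, 'b) ring_scheme \<Rightarrow> 'a set \<Rightarrow> 'a topology"
  where "adic_topology A I =
    topology (\<lambda>U. U \<subseteq> carrier A \<and> (\<forall>x\<in>U. \<exists>n. ideal_power A I n +>\<^bsub>A\<^esub> x \<subseteq> U))"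

lemma ideal_power_ideal:
  assumes "ideal I A"
  shows "ideal (ideal_power A I n) A"
proof -
  interpret ideal I A by (rule assms)
  show ?thesis
    by (induction n) (simp_all add: oneideal ideal_prod_is_ideal assms)
qed

lemma ideal_power_decseq:
  assumes "ideal I A" and "m \<le> n"
  shows "ideal_power A I n \<subseteq> ideal_power A I m"
proof -
  interpret ideal I A by (rule assms)
  show ?thesis
    using assms(2)
  proof (induction n rule: dec_induct)
    case (step n)
    then show ?case
      using ideal_prod_inter[OF ideal_power_ideal[OF assms(1), of n] assms(1)] by auto
  qed simp
qed

lemma openin_adic_topology:
  assumes "ideal I A"
  shows "openin (adic_topology A I) U \<longleftrightarrow>
    U \<subseteq> carrier A \<and> (\<forall>x\<in>U. \<exists>n. ideal_power A I n +>\<^bsub>A\<^esub> x \<subseteq> U)"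
proof -
  have mono: "ideal_power A I n +>\<^bsub>A\<^esub> x \<subseteq> ideal_power A I m +>\<^bsub>A\<^esub> x" if "m \<le> n" for m n x
    using ideal_power_decseq[OF assms that] by (auto simp: a_r_coset_def r_coset_def)
  have "istopology (\<lambda>U. U \<subseteq> carrier A \<and> (\<forall>x\<in>U. \<exists>n. ideal_power A I n +>\<^bsub>A\<^esub> x \<subseteq> U))"
    unfolding istopology_def
  proof (intro conjI allI impI ballI)
    fix S T
    assume "S \<subseteq> carrier A \<and> (\<forall>x\<in>S. \<exists>n. ideal_power A I n +>\<^bsub>A\<^esub> x \<subseteq> S)"
    then show "S \<inter> T \<subseteq> carrier A" by blast
  next
    fix S T x
    assume S: "S \<subseteq> carrier A \<and> (\<forall>x\<in>S. \<exists>n. ideal_power A I n +>\<^bsub>A\<^esub> x \<subseteq> S)"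
      and T: "T \<subseteq> carrier A \<and> (\<forall>x\<in>T. \<exists>n. ideal_power A I n +>\<^bsub>A\<^esub> x \<subseteq> T)"
      and x: "x \<in> S \<inter> T"
    obtain m n where "ideal_power A I m +>\<^bsub>A\<^esub> x \<subseteq> S" "ideal_power A I n +>\<^bsub>A\<^esub> x \<subseteq> T"
      using S T x by blast
    then have "ideal_power A I (max m n) +>\<^bsub>A\<^esub> x \<subseteq> S \<inter> T"
      using mono[of m "max m n" x] mono[of n "max m n" x] by auto
    then show "\<exists>n. ideal_power A I n +>\<^bsub>A\<^esub> x \<subseteq> S \<inter> T" by blast
  next
    fix K
    assume "\<forall>S\<in>K. S \<subseteq> carrier A \<and> (\<forall>x\<in>S. \<exists>n. ideal_power A I n +>\<^bsub>A\<^esub> x \<subseteq> S)"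
    then show "\<Union>K \<subseteq> carrier A" by blast
  next
    fix K x
    assume "\<forall>S\<in>K. S \<subseteq> carrier A \<and> (\<forall>x\<in>S. \<exists>n. ideal_power A I n +>\<^bsub>A\<^esub> x \<subseteq> S)"
      and "x \<in> \<Union>K"
    then show "\<exists>n. ideal_power A I n +>\<^bsub>A\<^esub> x \<subseteq> \<Union>K" by (meson Union_iff Union_upper subset_trans)
  qed
  then show ?thesis by (simp add: adic_topology_def topology_inverse')
qed

text \<open>\<open>A\<close> is separated and complete for its \<open>I\<close>-adic topology, i.e. \<open>A \<rightarrow> lim A/I\<^sup>n\<close> is
  bijective; an element of the inverse limit is given by representatives \<open>x n\<close> of its
  components in \<open>A/I\<^sup>n\<close>.\<close>

definition complete_adic_ring :: "('a, 'b) ring_scheme \<Rightarrow> 'a set \<Rightarrow> bool"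
  where "complete_adic_ring A I \<longleftrightarrow> cring A \<and> ideal I A \<and>
    (\<Inter>n. ideal_power A I n) = {\<zero>\<^bsub>A\<^esub>} \<and>
    (\<forall>x. (\<forall>n. x n \<in> carrier A) \<and> (\<forall>n. x (Suc n) \<ominus>\<^bsub>A\<^esub> x n \<in> ideal_power A I n) \<longrightarrow>
      (\<exists>l\<in>carrier A. \<forall>n. l \<ominus>\<^bsub>A\<^esub> x n \<in> ideal_power A I n))"

definition finitely_generated_ideal :: "('a, 'b) ring_scheme \<Rightarrow> 'a set \<Rightarrow> bool"
  where "finitely_generated_ideal A I \<longleftrightarrow>
    (\<exists>S. finite S \<and> S \<subseteq> carrier A \<and> I = genideal A S)"


section \<open>The ring \<open>R = W[[q - 1]]\<close>\<close>

text \<open>The variable of the formal power series ring \<^typ>\<open>'w fps\<close> is \<open>q - 1\<close>; \<open>q\<close> itself is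
  \<open>qvar\<close>.\<close>

definition qvar :: "'w::comm_ring_1 fps"
  where "qvar = 1 + fps_X"

definition R_ideal :: "'w::comm_ring_1 set \<Rightarrow> 'w fps set"
  where "R_ideal \<mm> = genideal ring_of_type_algebra (fps_const ` \<mm> \<union> {qvar - 1})"

abbreviation R_topology :: "'w::comm_ring_1 set \<Rightarrow> 'w fps topology"
  where "R_topology \<mm> \<equiv> adic_topology ring_of_type_algebra (R_ideal \<mm>)"

definition continuous_linear :: "'w::comm_ring_1 set \<Rightarrow> ('w fps \<Rightarrow> 'w fps) \<Rightarrow> bool"
  where "continuous_linear \<mm> D \<longleftrightarrow>
    module_hom (\<lambda>w f. fps_const w * f) (\<lambda>w f. fps_const w * f) D \<and>
    continuous_map (R_topology \<mm>) (R_topology \<mm>) D"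


section \<open>Twisted divided power algebras\<close>

text \<open>The free \<open>R\<close>-module on basis elements indexed by \<open>\<nat>\<close> is \<^typ>\<open>nat \<Rightarrow>\<^sub>0 'w fps\<close>;
  \<open>Poly_Mapping.single k a\<close> is \<open>a\<close> times the basis element of index \<open>k\<close>. The product is
  not the convolution product of \<^typ>\<open>nat \<Rightarrow>\<^sub>0 'w fps\<close>. The parameter \<open>c\<close> is the element whose
  \<open>i\<close>-th power occurs in the multiplication formula: \<open>q\<^sup>p - 1\<close> for \<open>R\<langle>\<xi>\<rangle>\<close> and \<open>q - 1\<close> for
  \<open>R\<langle>\<omega>\<rangle>\<close>.\<close>

definition twisted_mult ::
    "nat \<Rightarrow> 'w fps \<Rightarrow> (nat \<Rightarrow>\<^sub>0 'w fps) \<Rightarrow> (nat \<Rightarrow>\<^sub>0 'w fps) \<Rightarrow> (nat \<Rightarrow>\<^sub>0 'w::comm_ring_1 fps)"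
  where "twisted_mult p c f g =
    (\<Sum>m\<in>Poly_Mapping.keys f. \<Sum>n\<in>Poly_Mapping.keys g. \<Sum>i\<le>min m n.
      Poly_Mapping.single (m + n - i)
        (Poly_Mapping.lookup f m * Poly_Mapping.lookup g n *
         (qvar ^ (p * i * (i - 1) div 2) * qbinom (qvar ^ p) (m + n - i) m * qbinom (qvar ^ p) m i
           * c ^ i * qvar ^ i)))"

definition twisted_algebra :: "nat \<Rightarrow> 'w fps \<Rightarrow> (nat \<Rightarrow>\<^sub>0 'w::comm_ring_1 fps) ring"
  where "twisted_algebra p c =
    \<lparr>carrier = UNIV, monoid.mult = twisted_mult p c, one = Poly_Mapping.single 0 1,
     ring.zero = 0, add = (+)\<rparr>"

definition xi_algebra :: "nat \<Rightarrow> (nat \<Rightarrow>\<^sub>0 'w::comm_ring_1 fps) ring"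
  where "xi_algebra p = twisted_algebra p (qvar ^ p - 1)"

definition omega_algebra :: "nat \<Rightarrow> (nat \<Rightarrow>\<^sub>0 'w::comm_ring_1 fps) ring"
  where "omega_algebra p = twisted_algebra p (qvar - 1)"

text \<open>The free submodule on the basis elements of index \<open>> n\<close>.\<close>

definition tail_ideal :: "nat \<Rightarrow> (nat \<Rightarrow>\<^sub>0 'w::comm_ring_1 fps) set"
  where "tail_ideal n = {f. \<forall>k\<le>n. Poly_Mapping.lookup f k = 0}"

abbreviation truncation_class ::
    "(nat \<Rightarrow>\<^sub>0 'w::comm_ring_1 fps) ring \<Rightarrow> nat \<Rightarrow> (nat \<Rightarrow>\<^sub>0 'w fps) \<Rightarrow> (nat \<Rightarrow>\<^sub>0 'w fps) set"
  where "truncation_class A n f \<equiv> tail_ideal n +>\<^bsub>A\<^esub> f"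


section \<open>Taylor maps\<close>

text \<open>\<open>A\<close> is one of the two algebras. The truncation \<open>A / tail_ideal n\<close>, a finite free
  \<open>R\<close>-module, carries the topology of \<open>R\<close>, i.e. the adic topology for the extension of the
  ideal of definition of \<open>R\<close>.\<close>

definition truncation_topology ::
    "'w::comm_ring_1 set \<Rightarrow> (nat \<Rightarrow>\<^sub>0 'w fps) ring \<Rightarrow> nat \<Rightarrow> (nat \<Rightarrow>\<^sub>0 'w fps) set topology"
  where "truncation_topology \<mm> A n =
    adic_topology (A Quot tail_ideal n)
      (genideal (A Quot tail_ideal n)
        ((\<lambda>a. truncation_class A n (Poly_Mapping.single 0 a)) ` R_ideal \<mm>))"

text \<open>The continuous morphism of \<open>W\<close>-algebras \<open>R \<rightarrow> A / tail_ideal n\<close> sending \<open>q\<close> to the class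
  of \<open>v\<close>.\<close>

definition taylor_map ::
    "'w::comm_ring_1 set \<Rightarrow> (nat \<Rightarrow>\<^sub>0 'w fps) ring \<Rightarrow> (nat \<Rightarrow>\<^sub>0 'w fps) \<Rightarrow> nat
      \<Rightarrow> 'w fps \<Rightarrow> (nat \<Rightarrow>\<^sub>0 'w fps) set"
  where "taylor_map \<mm> A v n = (THE \<theta>.
    \<theta> \<in> ring_hom ring_of_type_algebra (A Quot tail_ideal n) \<and>
    (\<forall>w. \<theta> (fps_const w) = truncation_class A n (Poly_Mapping.single 0 (fps_const w))) \<and>
    continuous_map (R_topology \<mm>) (truncation_topology \<mm> A n) \<theta> \<and>
    \<theta> qvar = truncation_class A n v)"

definition taylor_xi ::
    "nat \<Rightarrow> 'w::comm_ring_1 set \<Rightarrow> nat \<Rightarrow> 'w fps \<Rightarrow> (nat \<Rightarrow>\<^sub>0 'w fps) set"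
  where "taylor_xi p \<mm> =
    taylor_map \<mm> (xi_algebra p) (Poly_Mapping.single 0 qvar + Poly_Mapping.single 1 1)"

definition taylor_omega ::
    "nat \<Rightarrow> 'w::comm_ring_1 set \<Rightarrow> nat \<Rightarrow> 'w fps \<Rightarrow> (nat \<Rightarrow>\<^sub>0 'w fps) set"
  where "taylor_omega p \<mm> =
    taylor_map \<mm> (omega_algebra p) (Poly_Mapping.single 0 qvar + Poly_Mapping.single 1 (qnum qvar p))"


section \<open>Higher twisted derivatives\<close>

text \<open>For \<open>k > n\<close> the Gaussian binomial coefficient vanishes, so that the truncated
  exponent \<open>n - k\<close> is harmless.\<close>

definition is_partial_xi ::
    "nat \<Rightarrow> 'w::comm_ring_1 set \<Rightarrow> nat \<Rightarrow> ('w fps \<Rightarrow> 'w fps) \<Rightarrow> bool"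
  where "is_partial_xi p \<mm> k D \<longleftrightarrow> continuous_linear \<mm> D \<and>
    (\<forall>n. D (qvar ^ n) = qfact (qvar ^ p) k * qbinom (qvar ^ p) n k * qvar ^ (n - k))"

definition is_partial_omega ::
    "nat \<Rightarrow> 'w::comm_ring_1 set \<Rightarrow> nat \<Rightarrow> ('w fps \<Rightarrow> 'w fps) \<Rightarrow> bool"
  where "is_partial_omega p \<mm> k D \<longleftrightarrow> continuous_linear \<mm> D \<and>
    (\<forall>n. D (qvar ^ n) = qnum qvar p ^ k * qfact (qvar ^ p) k * qbinom (qvar ^ p) n k * qvar ^ (n - k))"

definition partial_xi :: "nat \<Rightarrow> 'w::comm_ring_1 set \<Rightarrow> nat \<Rightarrow> 'w fps \<Rightarrow> 'w fps"
  where "partial_xi p \<mm> k = (THE D. is_partial_xi p \<mm> k D)"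

definition partial_omega :: "nat \<Rightarrow> 'w::comm_ring_1 set \<Rightarrow> nat \<Rightarrow> 'w fps \<Rightarrow> 'w fps"
  where "partial_omega p \<mm> k = (THE D. is_partial_omega p \<mm> k D)"

end

(*
  Write Q = q^p and let c, s satisfy s * c = Q - 1: (c, s) is (Q - 1, 1) for xi and (q - 1, (p)_q)
  for omega. Multiplication by e_1 is (e_1 e_k) = (k+1)_Q e_{k+1} + (k)_Q c q e_k, so that
  (q + s e_1) e_k = s (k+1)_Q e_{k+1} + Q^k q e_k. Iterating this rule on e_0 gives the powers of
  q + s e_1, whose e_k-coefficients are the prescribed values of the k-th derivative at powers of q.
  Likewise the e_k-coefficient of (q - 1 + s e_1)^j is divisible by (q - 1)^(j-k), because
  Q^k q - 1 is divisible by q - 1; hence the derivatives extend W-linearly to power series and move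
  the adic filtration by at most k steps. Multiplicativity of the Taylor map reduces by density to
  multiplication by q - 1, where it is associativity of the twisted product. Uniqueness holds
  because the W-span of the powers of q is dense and the adic topologies are separated.
*)

theory Submission
  imports Defs
begin

section \<open>Gaussian binomial identities\<close>

text \<open>Associativity of the twisted product is the hard input. Since (k+1)_Q e_{k+1} = (e_1 -
  (k)_Q c q) e_k, it would follow by induction from the case of a left factor e_1, but each step
  divides by (k+1)_Q, and q-integers need not be regular in W[[q-1]]. Associativity is therefore
  proved in Z[q], a domain in which q-integers are nonzero, and carried to any commutative ring by
  evaluation; c enters only through u = c q, as a power of u fixed by the degree.

  The Taylor coefficients of a power series need not vanish for large k, so the product is studied
  on all sequences. This is possible because entry N of a product depends only on entries up to N of
  the factors; for the same reason truncation is compatible with products.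

  Both topologies are described by coefficients: on R through the coefficients of (q-1)^j, on a
  truncation through those of the e_k with k <= n. Continuity and separatedness then become
  conditions on single coefficients.\<close>

lemma qnum_0 [simp]: "qnum q 0 = 0"
  by (simp add: qnum_def)

lemma qnum_1 [simp]: "qnum q (Suc 0) = 1"
  by (simp add: qnum_def)

lemma qnum_Suc: "qnum q (Suc n) = 1 + q * qnum q n"
  using qnum_add[of q 1 n] by simp

lemma qnum_mult_diff: "qnum q n * (q - 1) = q ^ n - 1"
  by (simp add: qnum_def power_diff_1_eq mult.commute)

lemma qbinom_Suc_1 [simp]: "qbinom q n (Suc 0) = qnum q n"
  by (induction n) (simp_all add: qnum_Suc)

lemma qbinom_Suc_dual:
  "k \<le> n \<Longrightarrow> qbinom q (Suc n) (Suc k) = q ^ (n - k) * qbinom q n k + qbinom q n (Suc k)"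
proof (induction n arbitrary: k)
  case 0
  then show ?case by simp
next
  case (Suc n)
  consider "k = Suc n" | "k = 0" | j where "k = Suc j" "k \<le> n"
    using Suc.prems by (metis le_SucE not0_implies_Suc)
  then show ?case
  proof cases
    case 1
    then show ?thesis using qbinom_self[of q "Suc (Suc n)"] qbinom_self[of q "Suc n"]
      by (simp add: qbinom_eq_0 del: qbinom.simps)
  next
    case 2
    have "qnum q (Suc (Suc n)) = q ^ Suc n + qnum q (Suc n)" by (simp add: qnum_def)
    then show ?thesis using 2 by (simp del: qbinom.simps(3))
  next
    case 3
    have e: "Suc n - k = Suc (n - k)" "n - j = Suc (n - k)" using 3 by auto
    have p: "q ^ (n - k) * q ^ k = q ^ n" by (metis 3(2) le_add_diff_inverse2 power_add)
    have "qbinom q (Suc (Suc n)) (Suc k) = qbinom q (Suc n) (Suc j) + q ^ Suc k * qbinom q (Suc n) (Suc k)"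
      using 3 by simp
    also have "\<dots> = q ^ (n - j) * qbinom q n j + qbinom q n k
        + q ^ Suc k * (q ^ (n - k) * qbinom q n k + qbinom q n (Suc k))"
      using Suc.IH[of j] Suc.IH[of k] 3 by (simp del: qbinom.simps)
    also have "\<dots> = q ^ (Suc n - k) * (qbinom q n j + q ^ k * qbinom q n k)
        + (qbinom q n k + q ^ Suc k * qbinom q n (Suc k))"
      unfolding e by (simp add: algebra_simps)
    finally show ?thesis using 3 by simp
  qed
qed

text \<open>Factorials cannot be cancelled over a general ring, so Pascal's rule and induction
  replace them. The hypothesis is applied at \<open>k\<close> and, once 1 is split off from
  \<open>qnum q (Suc k)\<close>, at \<open>k - 1\<close>.\<close>

lemma qbinom_absorb:
  "qnum q (Suc k) * qbinom q (Suc n) (Suc k) = qnum q (Suc n) * qbinom q n k"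
proof (induction n arbitrary: k)
  case 0
  then show ?case by (cases k) auto
next
  case (Suc n)
  have "qnum q (Suc k) * qbinom q (Suc (Suc n)) (Suc k)
      = qnum q (Suc k) * qbinom q (Suc n) k + q ^ Suc k * (qnum q (Suc k) * qbinom q (Suc n) (Suc k))"
    by (simp add: algebra_simps)
  also have "\<dots> = qnum q (Suc k) * qbinom q (Suc n) k + q ^ Suc k * qnum q (Suc n) * qbinom q n k"
    unfolding Suc.IH by (simp add: mult.assoc)
  also have "\<dots> = qnum q (Suc (Suc n)) * qbinom q (Suc n) k"
  proof (cases k)
    case 0
    then show ?thesis by (simp add: qnum_Suc)
  next
    case (Suc j)
    have "qnum q (Suc k) * qbinom q (Suc n) k
        = qbinom q (Suc n) k + q * (qnum q (Suc j) * qbinom q (Suc n) (Suc j))"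
      unfolding Suc by (simp add: qnum_Suc[of q "Suc j"] algebra_simps del: qbinom.simps)
    also have "\<dots> = qbinom q (Suc n) k + q * qnum q (Suc n) * qbinom q n j"
      unfolding Suc.IH by (simp add: mult.assoc)
    finally show ?thesis
      by (simp add: qnum_Suc[of q "Suc n"] Suc algebra_simps)
  qed
  finally show ?case .
qed

text \<open>With k = j + 1, write (n+1) = (n-j) + q^(n-j) (j+1); then \<open>qbinom_absorb\<close>
  and the dual Pascal rule apply.\<close>

lemma qbinom_absorb_comp:
  assumes "k \<le> Suc n"
  shows "qnum q (Suc n - k) * qbinom q (Suc n) k = qnum q (Suc n) * qbinom q n k"
proof (cases k)
  case 0
  then show ?thesis by simp
next
  case (Suc j)
  have "qnum q (Suc n) = qnum q (n - j) + q ^ (n - j) * qnum q (Suc j)"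
    using qnum_add[of q "n - j" "Suc j"] Suc assms by simp
  then have "qnum q (n - j) * qbinom q (Suc n) (Suc j) =
     qnum q (Suc n) * qbinom q (Suc n) (Suc j) - q ^ (n - j) * (qnum q (Suc j) * qbinom q (Suc n) (Suc j))"
    by (simp add: algebra_simps del: qbinom.simps)
  also have "\<dots> = qnum q (Suc n) * (qbinom q (Suc n) (Suc j) - q ^ (n - j) * qbinom q n j)"
    unfolding qbinom_absorb by (simp add: algebra_simps del: qbinom.simps)
  also have "\<dots> = qnum q (Suc n) * qbinom q n (Suc j)"
    using qbinom_Suc_dual[of j n q] Suc assms by (simp del: qbinom.simps)
  finally show ?thesis using Suc by (simp del: qbinom.simps)
qed


section \<open>Structure constants\<close>

text \<open>The coefficient of e_k in e_m e_n, with \<open>q\<close> in the role of Q and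
  \<open>u\<close> in the role of c q; m + n - k is the summation index i of the product formula.
  The guard keeps truncated subtraction from producing i = 0 when k > m + n. For k < m or k < n a
  binomial vanishes by itself.\<close>

definition struct_coeff :: "'a::comm_ring_1 \<Rightarrow> 'a \<Rightarrow> nat \<Rightarrow> nat \<Rightarrow> nat \<Rightarrow> 'a"
  where "struct_coeff q u m n k = (if k \<le> m + n then
    q ^ ((m + n - k) * (m + n - k - 1) div 2) * qbinom q k m * qbinom q m (m + n - k) * u ^ (m + n - k)
    else 0)"

lemma struct_coeff_eq_0:
  "k < m \<or> k < n \<or> m + n < k \<Longrightarrow> struct_coeff q u m n k = 0"
  by (auto simp: struct_coeff_def qbinom_eq_0)

lemma struct_coeff_0_left: "struct_coeff q u 0 n k = (if k = n then 1 else 0)"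
proof (cases "k < n")
  case True
  then show ?thesis by (simp add: struct_coeff_def qbinom_eq_0)
qed (auto simp: struct_coeff_def)

lemma struct_coeff_0_right: "struct_coeff q u m 0 k = (if k = m then 1 else 0)"
  by (cases "k < m") (auto simp: struct_coeff_def qbinom_eq_0 qbinom_self)

lemma struct_coeff_1_left:
  "struct_coeff q u (Suc 0) n k =
    (if k = Suc n then qnum q k else 0) + (if k = n then qnum q n * u else 0)"
proof -
  consider "k < n" | "k = n" | "k = Suc n" | "k > Suc n" by linarith
  then show ?thesis
  proof cases
    case 2
    then show ?thesis by (simp add: struct_coeff_def)
  next
    case 3
    then show ?thesis by (simp add: struct_coeff_def)
  qed (simp_all add: struct_coeff_eq_0)
qed

lemma triangle_Suc: "Suc j * j div 2 = j + j * (j - Suc 0) div 2"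
proof -
  have "Suc j * j = j * 2 + j * (j - Suc 0)" by (cases j) (auto simp: algebra_simps)
  then show ?thesis by (metis div_mult_self3 zero_neq_numeral)
qed

text \<open>Coefficient form of \<open>(e\<^sub>1 e\<^sub>m) e\<^sub>n = e\<^sub>1 (e\<^sub>m e\<^sub>n)\<close>.\<close>

lemma struct_coeff_rec:
  "qnum q (Suc m) * struct_coeff q u (Suc m) n k + qnum q m * u * struct_coeff q u m n k =
   qnum q k * struct_coeff q u m n (k - 1) + qnum q k * u * struct_coeff q u m n k"
proof (cases k)
  case 0
  then show ?thesis
    by (cases m) (simp_all add: struct_coeff_eq_0)
next
  case (Suc l)
  consider "k > Suc (m + n)" | "k = Suc (m + n)" | "k \<le> m + n" by linarith
  then show ?thesis
  proof cases
    case 1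
    then show ?thesis using Suc by (simp add: struct_coeff_eq_0)
  next
    case 2
    \<comment> \<open>Only terms with i = 0 survive here, and the claim is
      \<open>qbinom_absorb\<close>.\<close>
    then have l: "l = m + n" using Suc by simp
    show ?thesis unfolding 2
      using qbinom_absorb[of q m "m + n"] by (simp add: struct_coeff_def struct_coeff_eq_0 flip: mult.assoc del: qbinom.simps(2,3))
  next
    case 3
    define j where "j = m + n - k"
    define B where "B = qbinom q m j"
    let ?T = "\<lambda>i. i * (i - 1) div 2 :: nat"
    have i: "Suc m + n - k = Suc j" "m + n - l = Suc j" and ln: "l = m + n - Suc j" "Suc j \<le> m + n"
      using 3 Suc by (auto simp: j_def)
    show ?thesis
    proof (cases "j \<le> m")
      case False
      then have "k < n" "l < n" using ln Suc by auto
      then show ?thesis using Suc by (simp add: struct_coeff_eq_0)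
    next
      case True
      show ?thesis
      proof (cases "k < m")
        case True
        then show ?thesis using Suc by (simp add: struct_coeff_eq_0)
      next
        case False
        \<comment> \<open>After \<open>a\<close>, the dual Pascal rule \<open>d\<close> splits the
          binomial (m+1 over j+1). Its summand \<open>qbinom q m (Suc j)\<close> gives the term at
          \<open>l = k - 1\<close>; by \<open>b\<close> and \<open>c\<close> the summand with
          \<open>B\<close> gives ((k) - (m)) u times the term at \<open>k\<close>.\<close>
        have a: "qnum q (Suc m) * qbinom q k (Suc m) = qnum q k * qbinom q l m"
          using qbinom_absorb[of q m l] Suc by simp
        have b: "qnum q (k - m) * qbinom q k m = qnum q k * qbinom q l m"
          using qbinom_absorb_comp[of m l q] Suc False by simp
        have c: "qnum q k = qnum q m + q ^ m * qnum q (k - m)"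
          using qnum_add[of q m "k - m"] False by simp
        have d: "qbinom q (Suc m) (Suc j) = q ^ (m - j) * B + qbinom q m (Suc j)"
          unfolding B_def by (rule qbinom_Suc_dual[OF True])
        have e: "q ^ j * q ^ (m - j) = q ^ m"
          using True by (simp flip: power_add)
        have S1: "struct_coeff q u (Suc m) n k =
            q ^ j * q ^ ?T j * qbinom q k (Suc m) * qbinom q (Suc m) (Suc j) * u ^ Suc j"
          using 3 unfolding struct_coeff_def i by (simp add: triangle_Suc power_add del: qbinom.simps mult_Suc)
        have S2: "struct_coeff q u m n l =
            q ^ j * q ^ ?T j * qbinom q l m * qbinom q m (Suc j) * u ^ Suc j"
          using 3 Suc unfolding struct_coeff_def i by (simp add: triangle_Suc power_add del: qbinom.simps mult_Suc)
        have S3: "struct_coeff q u m n k = q ^ ?T j * qbinom q k m * B * u ^ j"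
          using 3 unfolding struct_coeff_def by (simp add: j_def B_def)
        have "qnum q (Suc m) * struct_coeff q u (Suc m) n k =
            (qnum q (Suc m) * qbinom q k (Suc m)) * (q ^ j * q ^ ?T j * qbinom q (Suc m) (Suc j) * u ^ Suc j)"
          unfolding S1 by (simp only: mult_ac)
        also have "\<dots> = (qnum q k * qbinom q l m) *
            ((q ^ j * q ^ (m - j)) * B + q ^ j * qbinom q m (Suc j)) * (q ^ ?T j * u ^ Suc j)"
          unfolding a d by (simp only: algebra_simps)
        also have "\<dots> = qnum q k * struct_coeff q u m n l +
            q ^ m * (qnum q k * qbinom q l m) * B * q ^ ?T j * u ^ Suc j"
          unfolding S2 e by (simp add: algebra_simps)
        also have "q ^ m * (qnum q k * qbinom q l m) * B * q ^ ?T j * u ^ Suc j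
            = (qnum q k - qnum q m) * u * struct_coeff q u m n k"
          unfolding b[symmetric] S3 unfolding c by (simp add: algebra_simps)
        finally show ?thesis using Suc by (simp add: algebra_simps)
      qed
    qed
  qed
qed

text \<open>By \<open>struct_coeff_rec\<close>, (l+1) e_{l+1} acts as e_1 e_l - (l) u e_l. Hence
  associativity for e_l yields it for e_{l+1} up to the factor (l+1), which the assumption
  cancels.\<close>

lemma struct_coeff_assoc_regular:
  fixes q u :: "'a::comm_ring_1"
  assumes regular: "\<And>j x. qnum q (Suc j) * x = 0 \<Longrightarrow> x = 0"
  shows "(\<Sum>k\<le>N. struct_coeff q u l m k * struct_coeff q u k n N) =
    (\<Sum>k\<le>N. struct_coeff q u m n k * struct_coeff q u l k N)"
proof (induction l arbitrary: N)
  case 0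
  have "(\<Sum>k\<le>N. struct_coeff q u 0 m k * struct_coeff q u k n N) =
      (\<Sum>k\<le>N. if k = m then struct_coeff q u m n N else 0)"
    by (intro sum.cong) (auto simp: struct_coeff_0_left)
  also have "\<dots> = struct_coeff q u m n N"
    by (auto simp: struct_coeff_eq_0)
  also have "\<dots> = (\<Sum>k\<le>N. if k = N then struct_coeff q u m n N else 0)" by simp
  also have "\<dots> = (\<Sum>k\<le>N. struct_coeff q u m n k * struct_coeff q u 0 k N)"
    by (intro sum.cong) (auto simp: struct_coeff_0_left)
  finally show ?case .
next
  case (Suc l)
  let ?S = "struct_coeff q u" and ?c = "qnum q"
  \<comment> \<open>\<open>L N\<close> and \<open>R N\<close> are the coefficients of e_N in (e_l
    e_m) e_n and in e_l (e_m e_n).\<close>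
  define L where "L N = (\<Sum>k\<le>N. ?S l m k * ?S k n N)" for N
  define R where "R N = (\<Sum>k\<le>N. ?S m n k * ?S l k N)" for N
  have LR: "L N = R N" for N unfolding L_def R_def by (rule Suc.IH)
  have rec: "?c (Suc l) * ?S (Suc l) m' k' =
      ?c k' * ?S l m' (k' - 1) + (?c k' * u - ?c l * u) * ?S l m' k'" for m' k'
    using struct_coeff_rec[of q l u m' k'] by (simp add: algebra_simps)
  have L1: "L (N - 1) * ?c N = (\<Sum>k\<le>N. ?S l m k * (?c N * ?S k n (N - 1)))"
  proof (cases N)
    case 0 then show ?thesis by simp
  next
    case (Suc M) then show ?thesis by (simp add: L_def sum_distrib_left mult_ac struct_coeff_eq_0)
  qed
  have R1: "R (N - 1) * ?c N = (\<Sum>k\<le>N. ?S m n k * (?c N * ?S l k (N - 1)))"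
  proof (cases N)
    case 0 then show ?thesis by simp
  next
    case (Suc M) then show ?thesis by (simp add: R_def sum_distrib_left mult_ac struct_coeff_eq_0)
  qed
  \<comment> \<open>No boundary terms arise: at k = 0 the factor \<open>qnum q 0\<close> is zero,
    and at k = N + 1 the product e_k e_n has no component e_N.\<close>
  have shift: "(\<Sum>k\<le>N. ?c k * ?S l m (k - 1) * ?S k n N) = (\<Sum>k\<le>N. ?S l m k * (?c (Suc k) * ?S (Suc k) n N))"
  proof -
    have "(\<Sum>k\<le>N. ?c k * ?S l m (k - 1) * ?S k n N) = (\<Sum>k\<le>Suc N. ?c k * ?S l m (k - 1) * ?S k n N)"
      by (simp add: struct_coeff_eq_0)
    also have "\<dots> = (\<Sum>k\<le>N. ?S l m k * (?c (Suc k) * ?S (Suc k) n N))"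
      by (subst sum.atMost_Suc_shift) (simp add: mult_ac)
    finally show ?thesis .
  qed
  \<comment> \<open>The left side, times (l+1), is expressed through \<open>L\<close>. Replacing
    \<open>L\<close> by \<open>R\<close> and reading the recursion backwards gives the right
    side.\<close>
  have "?c (Suc l) * (\<Sum>k\<le>N. ?S (Suc l) m k * ?S k n N) =
      (\<Sum>k\<le>N. (?c (Suc l) * ?S (Suc l) m k) * ?S k n N)"
    by (simp add: sum_distrib_left mult.assoc)
  also have "\<dots> = (\<Sum>k\<le>N. ?c k * ?S l m (k - 1) * ?S k n N)
      + (\<Sum>k\<le>N. ?S l m k * (?c k * u * ?S k n N)) - ?c l * u * L N"
    unfolding rec L_def sum_distrib_left sum_subtractf[symmetric] sum.distrib[symmetric]
    by (intro sum.cong refl) (simp add: algebra_simps)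
  also have "\<dots> = (\<Sum>k\<le>N. ?S l m k * (?c (Suc k) * ?S (Suc k) n N + ?c k * u * ?S k n N)) - ?c l * u * L N"
    unfolding shift by (simp add: sum.distrib distrib_left)
  also have "\<dots> = L (N - 1) * ?c N + (?c N * u - ?c l * u) * L N"
    unfolding struct_coeff_rec unfolding L1
    by (simp add: sum.distrib distrib_left L_def sum_distrib_left sum_subtractf algebra_simps)
  also have "\<dots> = (\<Sum>k\<le>N. ?S m n k * (?c (Suc l) * ?S (Suc l) k N))"
    unfolding LR R1 rec by (simp add: sum.distrib distrib_left R_def sum_distrib_left sum_subtractf algebra_simps)
  finally have "?c (Suc l) * ((\<Sum>k\<le>N. ?S (Suc l) m k * ?S k n N) -
      (\<Sum>k\<le>N. ?S m n k * ?S (Suc l) k N)) = 0"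
    by (simp add: sum_distrib_left mult_ac right_diff_distrib)
  from regular[OF this] show ?case by simp
qed

section \<open>Evaluation of integer polynomials in a commutative ring\<close>

definition eval_int_poly :: "'a::comm_ring_1 \<Rightarrow> int poly \<Rightarrow> 'a"
  where "eval_int_poly x P = poly (map_poly of_int P) x"

lemma eval_int_poly_pCons: "eval_int_poly x (pCons a P) = of_int a + x * eval_int_poly x P"
  by (simp add: eval_int_poly_def map_poly_pCons)

lemma eval_int_poly_0 [simp]: "eval_int_poly x 0 = 0"
  by (simp add: eval_int_poly_def)

lemma eval_int_poly_1 [simp]: "eval_int_poly x 1 = 1"
  by (simp add: eval_int_poly_def)

lemma eval_int_poly_add [simp]: "eval_int_poly x (P + Q) = eval_int_poly x P + eval_int_poly x Q"
  by (induction P Q rule: poly_induct2) (simp_all add: eval_int_poly_pCons algebra_simps)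

lemma eval_int_poly_smult: "eval_int_poly x (smult a P) = of_int a * eval_int_poly x P"
  by (induction P) (simp_all add: eval_int_poly_pCons algebra_simps)

lemma eval_int_poly_mult [simp]: "eval_int_poly x (P * Q) = eval_int_poly x P * eval_int_poly x Q"
  by (induction P) (simp_all add: eval_int_poly_pCons eval_int_poly_smult algebra_simps)

lemma eval_int_poly_power [simp]: "eval_int_poly x (P ^ n) = eval_int_poly x P ^ n"
  by (induction n) simp_all

lemma eval_int_poly_sum: "eval_int_poly x (sum f A) = (\<Sum>a\<in>A. eval_int_poly x (f a))"
  by (induction A rule: infinite_finite_induct) simp_all

lemma eval_int_poly_X [simp]: "eval_int_poly x [:0, 1:] = x"
  by (simp add: eval_int_poly_pCons)

lemma eval_int_poly_qbinom: "eval_int_poly x (qbinom [:0, 1:] n k) = qbinom x n k"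
  by (induction "[:0, 1:] :: int poly" n k rule: qbinom.induct) (simp_all add: eval_int_poly_pCons mult.assoc)

lemma eval_int_poly_struct_coeff:
  "eval_int_poly x (struct_coeff [:0, 1:] 1 m n k) = struct_coeff x 1 m n k"
  by (simp add: struct_coeff_def eval_int_poly_qbinom)

lemma struct_coeff_homogeneous:
  "struct_coeff q u m n k = u ^ (m + n - k) * struct_coeff q 1 m n k"
  by (simp add: struct_coeff_def)

lemma qnum_X_nonzero: "qnum [:0, 1:] (Suc n) \<noteq> (0 :: int poly)"
proof
  assume "qnum [:0, 1:] (Suc n) = (0 :: int poly)"
  \<comment> \<open>The constant term of a q-integer of positive index is 1.\<close>
  then have "poly (qnum [:0, 1:] (Suc n)) (0 :: int) = 0" by simp
  then show False by (simp add: qnum_Suc)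
qed

text \<open>The identity lives in \<open>\<int>[q]\<close>, where \<open>q\<close>-integers can be cancelled; every ring receives
  it by evaluation. The parameter \<open>u\<close> only contributes a homogeneous factor.\<close>

lemma struct_coeff_assoc:
  fixes q u :: "'a::comm_ring_1"
  shows "(\<Sum>k\<le>N. struct_coeff q u l m k * struct_coeff q u k n N) =
    (\<Sum>k\<le>N. struct_coeff q u m n k * struct_coeff q u l k N)"
proof -
  have "(\<Sum>k\<le>N. struct_coeff [:0, 1:] 1 l m k * struct_coeff [:0, 1:] 1 k n N) =
    (\<Sum>k\<le>N. struct_coeff [:0, 1:] 1 m n k * struct_coeff [:0, 1:] 1 l k N :: int poly)"
    by (rule struct_coeff_assoc_regular) (use qnum_X_nonzero in auto)
  from arg_cong[OF this, of "eval_int_poly q"]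
  have 1: "(\<Sum>k\<le>N. struct_coeff q 1 l m k * struct_coeff q 1 k n N) =
      (\<Sum>k\<le>N. struct_coeff q 1 m n k * struct_coeff q 1 l k N)"
    by (simp add: eval_int_poly_sum eval_int_poly_struct_coeff)
  \<comment> \<open>The two exponents of \<open>u\<close> add up to l + m + n - N, whatever
    \<open>k\<close> is. Where truncated subtraction would spoil this, one of the structure
    constants is zero.\<close>
  have L: "struct_coeff q u l m k * struct_coeff q u k n N =
      u ^ (l + m + n - N) * (struct_coeff q 1 l m k * struct_coeff q 1 k n N)" for k
  proof (cases "k \<le> l + m \<and> N \<le> k + n")
    case True
    then have "l + m + n - N = (l + m - k) + (k + n - N)" by simp
    then show ?thesis
      by (simp add: struct_coeff_homogeneous[of q u] power_add mult_ac)
  qed (auto simp: struct_coeff_eq_0)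
  have R: "struct_coeff q u m n k * struct_coeff q u l k N =
      u ^ (l + m + n - N) * (struct_coeff q 1 m n k * struct_coeff q 1 l k N)" for k
  proof (cases "k \<le> m + n \<and> N \<le> l + k")
    case True
    then have "l + m + n - N = (m + n - k) + (l + k - N)" by simp
    then show ?thesis
      by (simp add: struct_coeff_homogeneous[of q u] power_add mult_ac)
  qed (auto simp: struct_coeff_eq_0)
  show ?thesis
    unfolding L R sum_distrib_left[symmetric] 1 ..
qed


section \<open>The product on sequences\<close>

definition seq_mult :: "'a::comm_ring_1 \<Rightarrow> 'a \<Rightarrow> (nat \<Rightarrow> 'a) \<Rightarrow> (nat \<Rightarrow> 'a) \<Rightarrow> nat \<Rightarrow> 'a"
  where "seq_mult q u f g N = (\<Sum>m\<le>N. \<Sum>n\<le>N. f m * g n * struct_coeff q u m n N)"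

text \<open>Lets all nested sums run over one common range, so that they can be interchanged
  freely.\<close>

lemma seq_mult_bound:
  assumes "N \<le> K"
  shows "seq_mult q u f g N = (\<Sum>m\<le>K. \<Sum>n\<le>K. f m * g n * struct_coeff q u m n N)"
proof -
  have *: "(\<Sum>n\<le>N. f m * g n * struct_coeff q u m n N) = (\<Sum>n\<le>K. f m * g n * struct_coeff q u m n N)" for m
    by (rule sum.mono_neutral_left) (use assms in \<open>auto simp: struct_coeff_eq_0\<close>)
  show ?thesis unfolding seq_mult_def *
    by (rule sum.mono_neutral_left) (use assms in \<open>auto simp: struct_coeff_eq_0\<close>)
qed

lemma seq_mult_add_left: "seq_mult q u (\<lambda>k. f k + g k) h N = seq_mult q u f h N + seq_mult q u g h N"
  by (simp add: seq_mult_def sum.distrib algebra_simps)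

lemma seq_mult_add_right: "seq_mult q u h (\<lambda>k. f k + g k) N = seq_mult q u h f N + seq_mult q u h g N"
  by (simp add: seq_mult_def sum.distrib algebra_simps)

lemma seq_mult_single_left:
  "seq_mult q u (\<lambda>k. if k = j then a else 0) g N = a * (\<Sum>n\<le>N. g n * struct_coeff q u j n N)"
proof -
  have "seq_mult q u (\<lambda>k. if k = j then a else 0) g N =
      (\<Sum>m\<le>N. if m = j then a * (\<Sum>n\<le>N. g n * struct_coeff q u j n N) else 0)"
    unfolding seq_mult_def by (intro sum.cong) (auto simp: sum_distrib_left mult_ac)
  also have "\<dots> = a * (\<Sum>n\<le>N. g n * struct_coeff q u j n N)"
    by (auto simp: struct_coeff_eq_0)
  finally show ?thesis .
qed

lemma seq_mult_0_left: "seq_mult q u (\<lambda>k. if k = 0 then a else 0) g N = a * g N"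
proof -
  have "(\<Sum>n\<le>N. g n * struct_coeff q u 0 n N) = (\<Sum>n\<le>N. if n = N then g n else 0)"
    by (intro sum.cong) (auto simp: struct_coeff_0_left)
  then show ?thesis by (simp add: seq_mult_single_left)
qed

lemma seq_mult_1_right: "seq_mult q u f (\<lambda>k. if k = 0 then 1 else 0) N = f N"
proof -
  have "seq_mult q u f (\<lambda>k. if k = 0 then 1 else 0) N =
    (\<Sum>m\<le>N. \<Sum>n\<le>N. if n = 0 then (if m = N then f m else 0) else 0)"
    unfolding seq_mult_def by (intro sum.cong) (auto simp: struct_coeff_0_right)
  then show ?thesis by simp
qed

lemma seq_mult_1_left:
  "seq_mult q u (\<lambda>k. if k = 1 then a else 0) g N =
    a * ((if N = 0 then 0 else qnum q N * g (N - 1)) + qnum q N * u * g N)"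
proof -
  have "(\<Sum>n\<le>N. g n * struct_coeff q u (Suc 0) n N) =
     (\<Sum>n\<le>N. (if Suc n = N then qnum q N * g (N - 1) else 0) + (if n = N then qnum q N * u * g N else 0))"
    by (intro sum.cong) (auto simp: struct_coeff_1_left algebra_simps)
  also have "\<dots> = (if N = 0 then 0 else qnum q N * g (N - 1)) + qnum q N * u * g N"
    by (cases N) (simp_all add: sum.distrib)
  finally show ?thesis by (simp add: seq_mult_single_left del: One_nat_def add: One_nat_def[symmetric])
qed

lemma seq_mult_assoc:
  "seq_mult q u (seq_mult q u f g) h N = seq_mult q u f (seq_mult q u g h) N"
proof -
  let ?S = "struct_coeff q u"
  have swapped: "(\<Sum>n\<le>N. \<Sum>m\<le>N. f l * g m * h n * (\<Sum>k\<le>N. ?S m n k * ?S l k N)) =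
      (\<Sum>m\<le>N. \<Sum>n\<le>N. \<Sum>k\<le>N. f l * (g m * h n * ?S m n k) * ?S l k N)" for l
    by (subst sum.swap) (simp add: sum_distrib_left mult_ac)
  have "seq_mult q u (seq_mult q u f g) h N =
    (\<Sum>k\<le>N. \<Sum>n\<le>N. (\<Sum>l\<le>N. \<Sum>m\<le>N. f l * g m * ?S l m k) * h n * ?S k n N)"
    unfolding seq_mult_def[of q u "seq_mult q u f g"]
    by (intro sum.cong refl) (simp add: seq_mult_bound)
  also have "\<dots> = (\<Sum>k\<le>N. \<Sum>n\<le>N. \<Sum>l\<le>N. \<Sum>m\<le>N. f l * g m * h n * (?S l m k * ?S k n N))"
    by (simp add: sum_distrib_right sum_distrib_left mult_ac)
  also have "\<dots> = (\<Sum>n\<le>N. \<Sum>k\<le>N. \<Sum>l\<le>N. \<Sum>m\<le>N. f l * g m * h n * (?S l m k * ?S k n N))"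
    by (rule sum.swap)
  also have "\<dots> = (\<Sum>n\<le>N. \<Sum>l\<le>N. \<Sum>k\<le>N. \<Sum>m\<le>N. f l * g m * h n * (?S l m k * ?S k n N))"
    by (intro sum.cong refl sum.swap)
  also have "\<dots> = (\<Sum>n\<le>N. \<Sum>l\<le>N. \<Sum>m\<le>N. \<Sum>k\<le>N. f l * g m * h n * (?S l m k * ?S k n N))"
    by (intro sum.cong refl sum.swap)
  \<comment> \<open>The one step with content; all others reorder finite sums.\<close>
  also have "\<dots> = (\<Sum>n\<le>N. \<Sum>l\<le>N. \<Sum>m\<le>N. f l * g m * h n * (\<Sum>k\<le>N. ?S m n k * ?S l k N))"
    by (simp add: sum_distrib_left[symmetric] struct_coeff_assoc)
  also have "\<dots> = (\<Sum>l\<le>N. \<Sum>n\<le>N. \<Sum>m\<le>N. f l * g m * h n * (\<Sum>k\<le>N. ?S m n k * ?S l k N))"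
    by (rule sum.swap)
  also have "\<dots> = (\<Sum>l\<le>N. \<Sum>m\<le>N. \<Sum>n\<le>N. \<Sum>k\<le>N. f l * (g m * h n * ?S m n k) * ?S l k N)"
    by (intro sum.cong refl swapped)
  also have "\<dots> = (\<Sum>l\<le>N. \<Sum>m\<le>N. \<Sum>k\<le>N. \<Sum>n\<le>N. f l * (g m * h n * ?S m n k) * ?S l k N)"
    by (intro sum.cong refl sum.swap)
  also have "\<dots> = (\<Sum>l\<le>N. \<Sum>k\<le>N. \<Sum>m\<le>N. \<Sum>n\<le>N. f l * (g m * h n * ?S m n k) * ?S l k N)"
    by (intro sum.cong refl sum.swap)
  also have "\<dots> = (\<Sum>l\<le>N. \<Sum>k\<le>N. f l * (\<Sum>m\<le>N. \<Sum>n\<le>N. g m * h n * ?S m n k) * ?S l k N)"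
    by (simp add: sum_distrib_right sum_distrib_left)
  also have "\<dots> = seq_mult q u f (seq_mult q u g h) N"
    unfolding seq_mult_def[of q u f]
    by (intro sum.cong refl) (simp add: seq_mult_bound)
  finally show ?thesis .
qed


section \<open>Adic topologies and continuous maps\<close>

lemma topspace_adic_topology:
  assumes "ideal I A"
  shows "topspace (adic_topology A I) = carrier A"
proof -
  interpret ideal I A by (rule assms)
  have "openin (adic_topology A I) (carrier A)"
    unfolding openin_adic_topology[OF assms]
  proof (intro conjI ballI exI)
    show "ideal_power A I 0 +>\<^bsub>A\<^esub> x \<subseteq> carrier A" if "x \<in> carrier A" for x
      unfolding ideal_power.simps using that by (rule a_r_coset_subset_G[OF subset_refl])
  qed simp
  then show ?thesis
    using openin_subset openin_topspace[of "adic_topology A I"] openin_adic_topology[OF assms]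
    by (metis subset_antisym)
qed

lemma openin_adic_coset:
  assumes "ideal I A" "x \<in> carrier A"
  shows "openin (adic_topology A I) (ideal_power A I n +>\<^bsub>A\<^esub> x)"
proof -
  interpret P: ideal "ideal_power A I n" A by (rule ideal_power_ideal[OF assms(1)])
  show ?thesis
    unfolding openin_adic_topology[OF assms(1)]
    using P.a_r_coset_subset_G[OF P.a_subset assms(2)] P.a_repr_independence[OF _ assms(2) P.a_subgroup]
    by blast
qed

text \<open>For an additive map, continuity at zero gives continuity at every point by translation
  of cosets.\<close>

lemma continuous_map_adicI:
  assumes I: "ideal I A" and J: "ideal J B"
    and f: "\<And>x. x \<in> carrier A \<Longrightarrow> f x \<in> carrier B"
    and add: "\<And>x y. x \<in> carrier A \<Longrightarrow> y \<in> carrier A \<Longrightarrow> f (x \<oplus>\<^bsub>A\<^esub> y) = f x \<oplus>\<^bsub>B\<^esub> f y"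
    and small: "\<And>m. \<exists>n. f ` ideal_power A I n \<subseteq> ideal_power B J m"
  shows "continuous_map (adic_topology A I) (adic_topology B J) f"
  unfolding continuous_map_def topspace_adic_topology[OF I] topspace_adic_topology[OF J]
proof (intro conjI allI impI)
  show "f \<in> carrier A \<rightarrow> carrier B" using f by blast
next
  fix U assume "openin (adic_topology B J) U"
  then have U: "\<And>x. x \<in> U \<Longrightarrow> \<exists>n. ideal_power B J n +>\<^bsub>B\<^esub> x \<subseteq> U"
    by (simp add: openin_adic_topology[OF J])
  show "openin (adic_topology A I) {x \<in> carrier A. f x \<in> U}"
    unfolding openin_adic_topology[OF I]
  proof (intro conjI ballI)
    fix x assume x: "x \<in> {x \<in> carrier A. f x \<in> U}"
    then obtain m where m: "ideal_power B J m +>\<^bsub>B\<^esub> f x \<subseteq> U" using U by blast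
    obtain n where n: "f ` ideal_power A I n \<subseteq> ideal_power B J m" using small by blast
    have "y \<in> carrier A \<and> f y \<in> U" if y: "y \<in> ideal_power A I n +>\<^bsub>A\<^esub> x" for y
    proof -
      obtain h where h: "h \<in> ideal_power A I n" "y = h \<oplus>\<^bsub>A\<^esub> x"
        using y by (auto simp: a_r_coset_def')
      interpret P: ideal "ideal_power A I n" A by (rule ideal_power_ideal[OF I])
      have hc: "h \<in> carrier A" using h P.a_subset by blast
      have "f y = f h \<oplus>\<^bsub>B\<^esub> f x" using h hc x add by simp
      then have "f y \<in> ideal_power B J m +>\<^bsub>B\<^esub> f x"
        using n h by (auto simp: a_r_coset_def')
      then show ?thesis using m h hc x by auto
    qed
    then show "\<exists>n. ideal_power A I n +>\<^bsub>A\<^esub> x \<subseteq> {x \<in> carrier A. f x \<in> U}" by blast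
  qed auto
qed

text \<open>Limits are unique in a separated topology: for each m, continuity puts f x and g x in
  the coset modulo J^m of a common value f y = g y at a sufficiently close y, so their difference
  lies in every J^m.\<close>

lemma continuous_map_adic_eqI:
  assumes I: "ideal I A" and J: "ideal J B"
    and sep: "(\<Inter>n. ideal_power B J n) = {\<zero>\<^bsub>B\<^esub>}"
    and f: "continuous_map (adic_topology A I) (adic_topology B J) f"
    and g: "continuous_map (adic_topology A I) (adic_topology B J) g"
    and x: "x \<in> carrier A"
    and dense: "\<And>n. \<exists>y \<in> ideal_power A I n +>\<^bsub>A\<^esub> x. f y = g y"
  shows "f x = g x"
proof -
  interpret B: ideal J B by (rule J)
  have fx: "f x \<in> carrier B" and gx: "g x \<in> carrier B"
    using continuous_map_image_subset_topspace[OF f] continuous_map_image_subset_topspace[OF g] x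
    by (auto simp: topspace_adic_topology[OF I] topspace_adic_topology[OF J])
  have near: "\<exists>n. \<forall>y \<in> ideal_power A I n +>\<^bsub>A\<^esub> x. h y \<in> ideal_power B J m +>\<^bsub>B\<^esub> h x"
    if h: "continuous_map (adic_topology A I) (adic_topology B J) h" and hx: "h x \<in> carrier B" for h m
  proof -
    interpret P: ideal "ideal_power B J m" B by (rule ideal_power_ideal[OF J])
    have "openin (adic_topology A I) {y \<in> carrier A. h y \<in> ideal_power B J m +>\<^bsub>B\<^esub> h x}"
      using openin_continuous_map_preimage[OF h openin_adic_coset[OF J hx]]
      by (simp add: topspace_adic_topology[OF I])
    moreover have "h x \<in> ideal_power B J m +>\<^bsub>B\<^esub> h x" by (rule P.a_rcos_self[OF hx])
    ultimately show ?thesis using x unfolding openin_adic_topology[OF I] by fastforce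
  qed
  have "f x \<ominus>\<^bsub>B\<^esub> g x \<in> ideal_power B J m" for m
  proof -
    interpret P: ideal "ideal_power B J m" B by (rule ideal_power_ideal[OF J])
    obtain n1 where n1: "\<forall>y \<in> ideal_power A I n1 +>\<^bsub>A\<^esub> x. f y \<in> ideal_power B J m +>\<^bsub>B\<^esub> f x"
      using near[OF f fx] by blast
    obtain n2 where n2: "\<forall>y \<in> ideal_power A I n2 +>\<^bsub>A\<^esub> x. g y \<in> ideal_power B J m +>\<^bsub>B\<^esub> g x"
      using near[OF g gx] by blast
    obtain y where y: "y \<in> ideal_power A I (max n1 n2) +>\<^bsub>A\<^esub> x" "f y = g y"
      using dense by blast
    have "y \<in> ideal_power A I n1 +>\<^bsub>A\<^esub> x" "y \<in> ideal_power A I n2 +>\<^bsub>A\<^esub> x"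
      using y(1) ideal_power_decseq[OF I, of n1 "max n1 n2"] ideal_power_decseq[OF I, of n2 "max n1 n2"]
      by (auto simp: a_r_coset_def')
    with n1 n2 y have "f y \<in> ideal_power B J m +>\<^bsub>B\<^esub> f x" "f y \<in> ideal_power B J m +>\<^bsub>B\<^esub> g x"
      by auto
    then have "ideal_power B J m +>\<^bsub>B\<^esub> f x = ideal_power B J m +>\<^bsub>B\<^esub> g x"
      by (rule trans[OF B.a_repr_independence[OF _ fx P.a_subgroup]
        B.a_repr_independence[OF _ gx P.a_subgroup, symmetric]])
    then have "f x \<in> ideal_power B J m +>\<^bsub>B\<^esub> g x" using P.a_rcos_self[OF fx] by simp
    then show ?thesis using P.a_rcos_module_minus[OF B.ring_axioms gx fx] by simp
  qed
  then have "f x \<ominus>\<^bsub>B\<^esub> g x = \<zero>\<^bsub>B\<^esub>" using sep by blast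
  then show ?thesis using fx gx by simp
qed

section \<open>Ideals of a ring given by a type\<close>

lemma ring_of_type_algebra_simps [simp]:
  "carrier ring_of_type_algebra = UNIV"
  "x \<otimes>\<^bsub>ring_of_type_algebra\<^esub> y = x * y"
  "x \<oplus>\<^bsub>ring_of_type_algebra\<^esub> y = x + y"
  "\<one>\<^bsub>ring_of_type_algebra\<^esub> = 1"
  "\<zero>\<^bsub>ring_of_type_algebra\<^esub> = 0"
  by (simp_all add: ring_of_type_algebra_def)

lemma ideal_type_algebra_iff:
  fixes H :: "'a::comm_ring_1 set"
  shows "ideal H ring_of_type_algebra \<longleftrightarrow>
    0 \<in> H \<and> (\<forall>x\<in>H. \<forall>y\<in>H. x + y \<in> H) \<and> (\<forall>x\<in>H. \<forall>a. a * x \<in> H)"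
proof
  assume "ideal H ring_of_type_algebra"
  then interpret ideal H "ring_of_type_algebra" .
  show "0 \<in> H \<and> (\<forall>x\<in>H. \<forall>y\<in>H. x + y \<in> H) \<and> (\<forall>x\<in>H. \<forall>a. a * x \<in> H)"
    using additive_subgroup.zero_closed[OF is_additive_subgroup]
      additive_subgroup.a_closed[OF is_additive_subgroup] I_l_closed by simp
next
  assume H: "0 \<in> H \<and> (\<forall>x\<in>H. \<forall>y\<in>H. x + y \<in> H) \<and> (\<forall>x\<in>H. \<forall>a. a * x \<in> H)"
  interpret ring "ring_of_type_algebra :: 'a ring" by (rule ring_from_type_algebra)
  have m: "\<ominus>\<^bsub>ring_of_type_algebra\<^esub> y = - y" for y :: 'a by (rule minus_equality) auto
  show "ideal H ring_of_type_algebra"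
  proof (rule idealI)
    show "subgroup H (add_monoid (ring_of_type_algebra :: 'a ring))"
    proof (rule subgroup.intro)
      fix x assume "x \<in> H"
      then have "-1 * x \<in> H" using H by blast
      then have "- x \<in> H" by simp
      then show "inv\<^bsub>add_monoid (ring_of_type_algebra :: 'a ring)\<^esub> x \<in> H"
        by (metis a_inv_def m)
    qed (use H in auto)
  qed (use H ring_axioms in \<open>auto simp: mult.commute\<close>)
qed

lemma ideal_type_algebraD:
  assumes "ideal H (ring_of_type_algebra :: 'a::comm_ring_1 ring)"
  shows "0 \<in> H" "\<And>x y. x \<in> H \<Longrightarrow> y \<in> H \<Longrightarrow> x + y \<in> H"
    "\<And>x a. x \<in> H \<Longrightarrow> a * x \<in> H" "\<And>x a. x \<in> H \<Longrightarrow> x * a \<in> H"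
    "\<And>f F. (\<And>i. i \<in> F \<Longrightarrow> f i \<in> H) \<Longrightarrow> sum f F \<in> H"
proof -
  have H: "0 \<in> H \<and> (\<forall>x\<in>H. \<forall>y\<in>H. x + y \<in> H) \<and> (\<forall>x\<in>H. \<forall>a. a * x \<in> H)"
    using assms by (simp add: ideal_type_algebra_iff)
  then show "0 \<in> H" "\<And>x y. x \<in> H \<Longrightarrow> y \<in> H \<Longrightarrow> x + y \<in> H" "\<And>x a. x \<in> H \<Longrightarrow> a * x \<in> H" by auto
  show "\<And>x a. x \<in> H \<Longrightarrow> x * a \<in> H" using H by (metis mult.commute)
  show "(\<And>i. i \<in> F \<Longrightarrow> f i \<in> H) \<Longrightarrow> sum f F \<in> H" for f and F :: "'b set"
    by (induction F rule: infinite_finite_induct) (use H in auto)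
qed


section \<open>The twisted divided power algebras\<close>

lemma twisted_algebra_simps [simp]:
  "carrier (twisted_algebra p c) = UNIV"
  "f \<otimes>\<^bsub>twisted_algebra p c\<^esub> g = twisted_mult p c f g"
  "f \<oplus>\<^bsub>twisted_algebra p c\<^esub> g = f + g"
  "\<one>\<^bsub>twisted_algebra p c\<^esub> = Poly_Mapping.single 0 1"
  "\<zero>\<^bsub>twisted_algebra p c\<^esub> = 0"
  by (simp_all add: twisted_algebra_def)

text \<open>The bridge from the product on finitely supported families to \<open>seq_mult\<close>: Q
  = q^p takes the role of \<open>q\<close>, and \<open>u = c * qvar\<close> collects the two i-th
  powers of the formula.\<close>

lemma lookup_twisted_mult:
  "Poly_Mapping.lookup (twisted_mult p c f g) N =
    seq_mult (qvar ^ p) (c * qvar) (Poly_Mapping.lookup f) (Poly_Mapping.lookup g) N"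
proof -
  let ?f = "Poly_Mapping.lookup f" and ?g = "Poly_Mapping.lookup g"
    and ?S = "struct_coeff (qvar ^ p) (c * qvar)"
  \<comment> \<open>Because i (i-1) is even, p can be taken out of the division, and the power of q
    becomes a power of Q.\<close>
  have exponent: "p * i * (i - 1) div 2 = p * (i * (i - 1) div 2)" for i :: nat
  proof -
    have "even (i * (i - 1))" by (cases i) auto
    then show ?thesis by (metis div_mult_swap mult.assoc)
  qed
  have inner: "Poly_Mapping.lookup (\<Sum>i\<le>min m n. Poly_Mapping.single (m + n - i)
        (?f m * ?g n * (qvar ^ (p * i * (i - 1) div 2) * qbinom (qvar ^ p) (m + n - i) m *
          qbinom (qvar ^ p) m i * c ^ i * qvar ^ i))) N = ?f m * ?g n * ?S m n N" for m n
  proof -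
    let ?X = "\<lambda>i. ?f m * ?g n * (qvar ^ (p * i * (i - 1) div 2) * qbinom (qvar ^ p) (m + n - i) m *
          qbinom (qvar ^ p) m i * c ^ i * qvar ^ i)"
    have "Poly_Mapping.lookup (\<Sum>i\<le>min m n. Poly_Mapping.single (m + n - i) (?X i)) N =
        (\<Sum>i\<le>min m n. if m + n - i = N then ?X i else 0)"
      by (simp only: lookup_sum lookup_single when_def)
    also have "\<dots> = ?f m * ?g n * ?S m n N"
    proof (cases "m \<le> N \<and> n \<le> N \<and> N \<le> m + n")
      case True
      have "(\<Sum>i\<le>min m n. if m + n - i = N then ?X i else 0) =
          (\<Sum>i\<le>min m n. if i = m + n - N then ?X i else 0)"
        using True by (intro sum.cong refl if_cong) auto
      also have "\<dots> = ?X (m + n - N)" using True by auto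
      also have "\<dots> = ?f m * ?g n * ?S m n N"
        unfolding exponent using True
        by (simp add: struct_coeff_def power_mult_distrib power_mult mult_ac)
      finally show ?thesis .
    next
      case False
      then have "(\<Sum>i\<le>min m n. if m + n - i = N then ?X i else 0) = 0"
        by (intro sum.neutral) auto
      then show ?thesis using False by (auto simp: struct_coeff_eq_0)
    qed
    finally show ?thesis .
  qed
  obtain K where K: "Poly_Mapping.keys f \<subseteq> {..K}" "Poly_Mapping.keys g \<subseteq> {..K}" "N \<le> K"
  proof
    define K where "K = Max (Poly_Mapping.keys f \<union> Poly_Mapping.keys g \<union> {N})"
    show "Poly_Mapping.keys f \<subseteq> {..K}" "Poly_Mapping.keys g \<subseteq> {..K}" "N \<le> K"
      by (auto simp: K_def intro!: Max_ge)
  qed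
  have "Poly_Mapping.lookup (twisted_mult p c f g) N =
      (\<Sum>m\<in>Poly_Mapping.keys f. \<Sum>n\<in>Poly_Mapping.keys g. ?f m * ?g n * ?S m n N)"
    unfolding twisted_mult_def lookup_sum[of _ "Poly_Mapping.keys f"] lookup_sum[of _ "Poly_Mapping.keys g"] inner ..
  also have "\<dots> = (\<Sum>m\<in>Poly_Mapping.keys f. \<Sum>n\<le>K. ?f m * ?g n * ?S m n N)"
    by (intro sum.cong refl sum.mono_neutral_left) (use K in \<open>auto simp: in_keys_iff\<close>)
  also have "\<dots> = (\<Sum>m\<le>K. \<Sum>n\<le>K. ?f m * ?g n * ?S m n N)"
    by (intro sum.mono_neutral_left) (use K in \<open>auto simp: in_keys_iff\<close>)
  also have "\<dots> = seq_mult (qvar ^ p) (c * qvar) ?f ?g N"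
    by (rule seq_mult_bound[symmetric, OF K(3)])
  finally show ?thesis .
qed

lemma lookup_add_fun: "Poly_Mapping.lookup (f + g) = (\<lambda>k. Poly_Mapping.lookup f k + Poly_Mapping.lookup g k)"
  by (simp add: fun_eq_iff lookup_add)

lemma lookup_single_fun: "Poly_Mapping.lookup (Poly_Mapping.single j a) = (\<lambda>k. if k = j then a else 0)"
  by (auto simp: fun_eq_iff lookup_single when_def)

lemma lookup_twisted_mult_fun:
  "Poly_Mapping.lookup (twisted_mult p c f g) =
    seq_mult (qvar ^ p) (c * qvar) (Poly_Mapping.lookup f) (Poly_Mapping.lookup g)"
  by (simp add: fun_eq_iff lookup_twisted_mult)

lemma twisted_algebra_ring: "ring (twisted_algebra p c)"
proof (rule ringI)
  show "abelian_group (twisted_algebra p c)"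
    by (rule abelian_groupI) (auto simp: algebra_simps intro: exI[of _ "- x" for x])
  show "Group.monoid (twisted_algebra p c)"
    by (rule monoidI)
      (auto intro!: poly_mapping_eqI simp: lookup_twisted_mult_fun seq_mult_assoc lookup_single_fun
        seq_mult_0_left seq_mult_1_right simp del: single_one)
qed (auto intro!: poly_mapping_eqI
  simp: lookup_twisted_mult_fun lookup_add_fun seq_mult_add_left seq_mult_add_right)

text \<open>One shape for two kinds of ideals: H = {0} gives \<open>tail_ideal\<close>, and a power
  of the ideal of definition of R gives the preimage of a basic neighbourhood of zero in the
  truncation.\<close>

definition coeff_ideal :: "nat \<Rightarrow> 'w fps set \<Rightarrow> (nat \<Rightarrow>\<^sub>0 'w::comm_ring_1 fps) set"
  where "coeff_ideal n H = {f. \<forall>k\<le>n. Poly_Mapping.lookup f k \<in> H}"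

lemma tail_ideal_eq: "tail_ideal n = coeff_ideal n {0}"
  by (simp add: tail_ideal_def coeff_ideal_def)

text \<open>Coefficient N of a product is a combination of products of coefficients of index at most
  N, so the condition on indices up to \<open>n\<close> is stable.\<close>

lemma coeff_ideal_ideal:
  assumes "ideal H (ring_of_type_algebra :: 'w::comm_ring_1 fps ring)"
  shows "ideal (coeff_ideal n H) (twisted_algebra p c)"
proof -
  note H = ideal_type_algebraD[OF assms]
  interpret ring "twisted_algebra p c" by (rule twisted_algebra_ring)
  have m: "\<ominus>\<^bsub>twisted_algebra p c\<^esub> f = - f" for f by (rule minus_equality) auto
  show ?thesis
  proof (rule idealI)
    show "subgroup (coeff_ideal n H) (add_monoid (twisted_algebra p c))"
    proof (rule subgroup.intro)
      fix x assume "x \<in> coeff_ideal n H"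
      then have "- x \<in> coeff_ideal n H"
        using H(3)[where a = "-1"] by (auto simp: coeff_ideal_def)
      then show "inv\<^bsub>add_monoid (twisted_algebra p c)\<^esub> x \<in> coeff_ideal n H"
        by (metis a_inv_def m)
    qed (use H in \<open>auto simp: coeff_ideal_def lookup_add\<close>)
    show "x \<otimes>\<^bsub>twisted_algebra p c\<^esub> a \<in> coeff_ideal n H"
      "a \<otimes>\<^bsub>twisted_algebra p c\<^esub> x \<in> coeff_ideal n H" if "a \<in> coeff_ideal n H" for a x
      using that H(3,4) by (auto simp: coeff_ideal_def lookup_twisted_mult seq_mult_def mult.assoc intro!: H(5))
  qed (rule ring_axioms)
qed

section \<open>Truncations and their adic topology\<close>

lemma tail_ideal_ideal: "ideal (tail_ideal n) (twisted_algebra p c)"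
  unfolding tail_ideal_eq
  by (rule coeff_ideal_ideal) (simp add: ideal_type_algebra_iff)

lemma truncation_class_eq:
  "truncation_class (twisted_algebra p c) n f = {g. \<forall>k\<le>n. Poly_Mapping.lookup g k = Poly_Mapping.lookup f k}"
proof (rule Set.set_eqI, rule iffI)
  fix g assume "g \<in> truncation_class (twisted_algebra p c) n f"
  then show "g \<in> {g. \<forall>k\<le>n. Poly_Mapping.lookup g k = Poly_Mapping.lookup f k}"
    by (auto simp: a_r_coset_def' tail_ideal_def lookup_add)
next
  fix g assume "g \<in> {g. \<forall>k\<le>n. Poly_Mapping.lookup g k = Poly_Mapping.lookup f k}"
  then have "g - f \<in> tail_ideal n" by (simp add: tail_ideal_def lookup_minus)
  then show "g \<in> truncation_class (twisted_algebra p c) n f"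
    unfolding a_r_coset_def' by (auto intro!: bexI[of _ "g - f"])
qed

lemma truncation_class_eq_iff:
  "truncation_class (twisted_algebra p c) n f = truncation_class (twisted_algebra p c) n g \<longleftrightarrow>
    (\<forall>k\<le>n. Poly_Mapping.lookup f k = Poly_Mapping.lookup g k)"
  unfolding truncation_class_eq by (auto simp: set_eq_iff)

lemma truncation_ring: "ring (twisted_algebra p c Quot tail_ideal n)"
  by (rule ideal.quotient_is_ring[OF tail_ideal_ideal])

lemma carrier_truncation:
  "carrier (twisted_algebra p c Quot tail_ideal n) = range (truncation_class (twisted_algebra p c) n)"
  by (auto simp: FactRing_def A_RCOSETS_def')

lemma truncation_class_mult:
  "truncation_class (twisted_algebra p c) n f \<otimes>\<^bsub>twisted_algebra p c Quot tail_ideal n\<^esub>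
    truncation_class (twisted_algebra p c) n g = truncation_class (twisted_algebra p c) n (twisted_mult p c f g)"
  using ring_hom_mult[OF ideal.rcos_ring_hom[OF tail_ideal_ideal], of f p c g n] by simp

lemma truncation_class_add:
  "truncation_class (twisted_algebra p c) n f \<oplus>\<^bsub>twisted_algebra p c Quot tail_ideal n\<^esub>
    truncation_class (twisted_algebra p c) n g = truncation_class (twisted_algebra p c) n (f + g)"
  using ring_hom_add[OF ideal.rcos_ring_hom[OF tail_ideal_ideal], of f p c g n] by simp

lemma truncation_class_one:
  "truncation_class (twisted_algebra p c) n (Poly_Mapping.single 0 1) =
    \<one>\<^bsub>twisted_algebra p c Quot tail_ideal n\<^esub>"
  using ring_hom_one[OF ideal.rcos_ring_hom[OF tail_ideal_ideal], of p c n] by simp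

lemma truncation_class_zero:
  "truncation_class (twisted_algebra p c) n 0 = \<zero>\<^bsub>twisted_algebra p c Quot tail_ideal n\<^esub>"
  unfolding truncation_class_eq by (simp add: FactRing_def tail_ideal_def)

lemma truncation_class_mem_iff:
  "truncation_class (twisted_algebra p c) n f \<in> truncation_class (twisted_algebra p c) n ` coeff_ideal n H
    \<longleftrightarrow> (\<forall>k\<le>n. Poly_Mapping.lookup f k \<in> H)"
  unfolding image_iff truncation_class_eq_iff coeff_ideal_def by force

lemma truncated_ideal_ideal:
  assumes "ideal H (ring_of_type_algebra :: 'w::comm_ring_1 fps ring)"
  shows "ideal (truncation_class (twisted_algebra p c) n ` coeff_ideal n H)
    (twisted_algebra p c Quot tail_ideal n)"
  by (rule ring.ring_ideal_imp_quot_ideal[OF twisted_algebra_ring tail_ideal_ideal coeff_ideal_ideal[OF assms]])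

lemma twisted_mult_single_0:
  "twisted_mult p c (Poly_Mapping.single 0 a) (Poly_Mapping.single k b) = Poly_Mapping.single k (a * b)"
  by (rule poly_mapping_eqI) (simp add: lookup_twisted_mult_fun lookup_single_fun seq_mult_0_left)

text \<open>The truncation is free on e_0, ..., e_n, so its adic filtration is the filtration of R
  on each coefficient. This turns continuity into the truncation, and its separatedness, into
  statements about R.\<close>

lemma ideal_power_truncation:
  fixes I :: "'w::comm_ring_1 fps set" and p n m :: nat and c :: "'w fps"
  assumes I: "ideal I ring_of_type_algebra"
  defines "A \<equiv> twisted_algebra p c"
  defines "B \<equiv> A Quot tail_ideal n"
  defines "J \<equiv> genideal B ((\<lambda>a. truncation_class A n (Poly_Mapping.single 0 a)) ` I)"
  shows "ideal J B"
    and "ideal_power B J m = truncation_class A n ` coeff_ideal n (ideal_power ring_of_type_algebra I m)"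
proof -
  let ?c = "truncation_class A n" and ?P = "\<lambda>m. ideal_power ring_of_type_algebra I m"
  interpret B: ring B unfolding A_def B_def by (rule truncation_ring)
  note P = ideal_power_ideal[OF I]
  have carrier_B: "carrier B = range ?c" unfolding A_def B_def by (rule carrier_truncation)
  have mult: "?c f \<otimes>\<^bsub>B\<^esub> ?c g = ?c (twisted_mult p c f g)" for f g
    unfolding A_def B_def by (rule truncation_class_mult)
  have add: "?c f \<oplus>\<^bsub>B\<^esub> ?c g = ?c (f + g)" for f g
    unfolding A_def B_def by (rule truncation_class_add)
  have gens: "(\<lambda>a. ?c (Poly_Mapping.single 0 a)) ` I \<subseteq> carrier B" by (auto simp: carrier_B)
  show J: "ideal J B" unfolding J_def by (rule B.genideal_ideal[OF gens])
  have J_le: "J \<subseteq> ?c ` coeff_ideal n I"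
    unfolding J_def
  proof (rule B.genideal_minimal)
    show "ideal (?c ` coeff_ideal n I) B"
      unfolding A_def B_def by (rule truncated_ideal_ideal[OF I])
    show "(\<lambda>a. ?c (Poly_Mapping.single 0 a)) ` I \<subseteq> ?c ` coeff_ideal n I"
      using ideal_type_algebraD(1)[OF I]
      by (auto simp: A_def truncation_class_mem_iff lookup_single when_def)
  qed
  have upper: "ideal_power B J m \<subseteq> ?c ` coeff_ideal n (?P m)"
  proof (induction m)
    case 0
    then show ?case by (auto simp: carrier_B coeff_ideal_def)
  next
    case (Suc m)
    interpret K: ideal "?c ` coeff_ideal n (?P (Suc m))" B
      unfolding A_def B_def by (rule truncated_ideal_ideal[OF P])
    show ?case
    proof
      fix x assume "x \<in> ideal_power B J (Suc m)"
      then have "x \<in> ideal_prod B (ideal_power B J m) J" by simp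
      then show "x \<in> ?c ` coeff_ideal n (?P (Suc m))"
      proof (induction rule: ideal_prod.induct)
        case (prod i j)
        obtain f where f: "i = ?c f" "f \<in> coeff_ideal n (?P m)" using prod Suc by blast
        obtain g where g: "j = ?c g" "g \<in> coeff_ideal n I" using prod J_le by blast
        have "Poly_Mapping.lookup f a * Poly_Mapping.lookup g b \<in> ?P (Suc m)" if "a \<le> n" "b \<le> n" for a b
          using f g that ideal_prod.prod[of "Poly_Mapping.lookup f a" "?P m" "Poly_Mapping.lookup g b" I
              "ring_of_type_algebra"]
          by (simp add: coeff_ideal_def)
        then have "twisted_mult p c f g \<in> coeff_ideal n (?P (Suc m))"
          using ideal_type_algebraD(4)[OF P[of "Suc m"]]
          by (auto simp: coeff_ideal_def lookup_twisted_mult seq_mult_def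
            simp del: ideal_power.simps intro!: ideal_type_algebraD(5)[OF P])
        then show ?case using f g mult by auto
      next
        case (sum s t)
        then show ?case by (intro additive_subgroup.a_closed[OF K.is_additive_subgroup])
      qed
    qed
  qed
  have J_m: "ideal (ideal_power B J m) B" for m by (rule ideal_power_ideal[OF J])
  have scalar: "a \<in> ?P m \<Longrightarrow> ?c (Poly_Mapping.single 0 a) \<in> ideal_power B J m" for a
  proof (induction m arbitrary: a)
    case 0
    then show ?case by (simp add: carrier_B)
  next
    case (Suc m)
    from Suc.prems have "a \<in> ideal_prod ring_of_type_algebra (?P m) I" by simp
    then show ?case
    proof (induction rule: ideal_prod.induct)
      case (prod i j)
      have "?c (Poly_Mapping.single 0 j) \<in> J"
        using B.genideal_self[OF gens] prod unfolding J_def by auto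
      from ideal_prod.prod[OF Suc.IH[OF prod(1)] this, of B] show ?case
        by (simp add: mult twisted_mult_single_0)
    next
      case (sum s t)
      from ideal_prod.sum[OF sum.IH[simplified]] show ?case by (simp add: add single_add)
    qed
  qed
  \<comment> \<open>Up to the tail, f is the sum of its scalars times e_k; \<open>scalar\<close>
    puts each scalar in J^m, and the ideal property does the rest.\<close>
  have lower: "?c f \<in> ideal_power B J m" if f: "\<forall>k\<le>n. Poly_Mapping.lookup f k \<in> ?P m" for f
  proof -
    interpret Jm: ideal "ideal_power B J m" B by (rule J_m)
    have single: "?c (Poly_Mapping.single k (Poly_Mapping.lookup f k)) \<in> ideal_power B J m" if "k \<le> n" for k
    proof -
      have "?c (Poly_Mapping.single 0 (Poly_Mapping.lookup f k)) \<otimes>\<^bsub>B\<^esub> ?c (Poly_Mapping.single k 1) \<in> ideal_power B J m"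
        by (rule Jm.I_r_closed[OF scalar]) (use f that in \<open>auto simp: carrier_B\<close>)
      then show ?thesis by (simp add: mult twisted_mult_single_0)
    qed
    have zero: "?c 0 \<in> ideal_power B J m"
      using additive_subgroup.zero_closed[OF Jm.is_additive_subgroup]
      unfolding A_def B_def truncation_class_zero by simp
    have "?c (\<Sum>k\<in>F. Poly_Mapping.single k (Poly_Mapping.lookup f k)) \<in> ideal_power B J m"
      if "F \<subseteq> {..n}" for F
      using finite_subset[OF that finite_atMost] that
    proof (induction F rule: finite_induct)
      case (insert k F)
      then have "?c (Poly_Mapping.single k (Poly_Mapping.lookup f k)) \<oplus>\<^bsub>B\<^esub>
          ?c (\<Sum>k\<in>F. Poly_Mapping.single k (Poly_Mapping.lookup f k)) \<in> ideal_power B J m"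
        by (intro additive_subgroup.a_closed[OF Jm.is_additive_subgroup] single) auto
      then show ?case using insert.hyps by (simp add: add)
    qed (simp add: zero)
    from this[OF subset_refl] have "?c (\<Sum>k\<le>n. Poly_Mapping.single k (Poly_Mapping.lookup f k)) \<in> ideal_power B J m" .
    moreover have "?c (\<Sum>k\<le>n. Poly_Mapping.single k (Poly_Mapping.lookup f k)) = ?c f"
      unfolding A_def truncation_class_eq_iff by (simp add: lookup_sum lookup_single when_def)
    ultimately show ?thesis by simp
  qed
  show "ideal_power B J m = ?c ` coeff_ideal n (?P m)"
    using upper lower by (auto simp: coeff_ideal_def)
qed


section \<open>The adic filtration of \<open>W[[q - 1]]\<close>\<close>

text \<open>By definition the first power is the product of the whole ring with \<open>I\<close>, so
  a witness with left factor 1 is needed.\<close>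

lemma ideal_power_1:
  assumes "ideal I (ring_of_type_algebra :: 'a::comm_ring_1 ring)"
  shows "ideal_power ring_of_type_algebra I 1 = I"
proof -
  interpret ideal I "ring_of_type_algebra :: 'a ring" by (rule assms)
  have "x \<in> ideal_power ring_of_type_algebra I 1" if "x \<in> I" for x
    using ideal_prod.prod[of 1 UNIV x I "ring_of_type_algebra :: 'a ring"] that by simp
  moreover have "ideal_power ring_of_type_algebra I 1 \<subseteq> I"
    using ideal_prod_inter[OF oneideal assms] by simp
  ultimately show ?thesis by blast
qed

text \<open>The expected coefficient description of the powers of \<open>R_ideal\<close>: a term in
  (q-1)^j already carries j factors and needs only m - j more from W. For j >= m nothing is
  required.\<close>

definition adic_filtration :: "'w::comm_ring_1 set \<Rightarrow> nat \<Rightarrow> 'w fps set"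
  where "adic_filtration \<mm> m = {f. \<forall>j<m. fps_nth f j \<in> ideal_power ring_of_type_algebra \<mm> (m - j)}"

lemma adic_filtration_ideal:
  fixes \<mm> :: "'w::comm_ring_1 set"
  assumes I: "ideal \<mm> ring_of_type_algebra"
  shows "ideal (adic_filtration \<mm> m) ring_of_type_algebra"
  unfolding ideal_type_algebra_iff
proof (intro conjI ballI allI)
  note P = ideal_type_algebraD[OF ideal_power_ideal[OF I]]
  show "0 \<in> adic_filtration \<mm> m" by (simp add: adic_filtration_def P)
  show "x + y \<in> adic_filtration \<mm> m" if "x \<in> adic_filtration \<mm> m" "y \<in> adic_filtration \<mm> m" for x y
    using that by (simp add: adic_filtration_def P)
  show "a * x \<in> adic_filtration \<mm> m" if x: "x \<in> adic_filtration \<mm> m" for a x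
    unfolding adic_filtration_def fps_mult_nth mem_Collect_eq
  proof (intro allI impI P(5) P(3))
    fix j i assume "j < m" "i \<in> {0..j}"
    then have "j - i < m" by simp
    then have "fps_nth x (j - i) \<in> ideal_power ring_of_type_algebra \<mm> (m - (j - i))"
      using x unfolding adic_filtration_def by blast
    then show "fps_nth x (j - i) \<in> ideal_power ring_of_type_algebra \<mm> (m - j)"
      by (rule subsetD[OF ideal_power_decseq[OF I], rotated]) simp
  qed
qed

lemma fps_cutoff_eq_sum:
  "fps_cutoff n f = (\<Sum>j<n. fps_const (fps_nth f j) * fps_X ^ j)"
proof (rule fps_ext)
  fix i
  have "fps_nth (\<Sum>j<n. fps_const (fps_nth f j) * fps_X ^ j) i = (\<Sum>j<n. if j = i then fps_nth f i else 0)"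
    unfolding fps_sum_nth by (intro sum.cong) auto
  then show "fps_nth (fps_cutoff n f) i = fps_nth (\<Sum>j<n. fps_const (fps_nth f j) * fps_X ^ j) i"
    by simp
qed

lemma R_ideal_ideal: "ideal (R_ideal \<mm>) ring_of_type_algebra"
  unfolding R_ideal_def by (rule ring.genideal_ideal[OF ring_from_type_algebra]) simp

lemma R_ideal_generators:
  shows "w \<in> \<mm> \<Longrightarrow> fps_const w \<in> R_ideal \<mm>" and "fps_X \<in> R_ideal \<mm>"
  using ring.genideal_self[OF ring_from_type_algebra, of "fps_const ` \<mm> \<union> {qvar - 1}"]
  by (auto simp: R_ideal_def qvar_def)

text \<open>In coefficient j of f g, the terms with i < j gain a step from the smaller index of f,
  and the term with i = j gains it from the constant coefficient of g, which lies in the ideal of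
  W.\<close>

lemma adic_filtration_mult:
  fixes \<mm> :: "'w::comm_ring_1 set"
  assumes I: "ideal \<mm> ring_of_type_algebra"
    and f: "f \<in> adic_filtration \<mm> m" and g: "g \<in> adic_filtration \<mm> 1"
  shows "f * g \<in> adic_filtration \<mm> (Suc m)"
  unfolding adic_filtration_def fps_mult_nth mem_Collect_eq
proof (intro allI impI)
  note P = ideal_type_algebraD[OF ideal_power_ideal[OF I]]
  fix j assume j: "j < Suc m"
  have g0: "fps_nth g 0 \<in> \<mm>" using g ideal_power_1[OF I] by (simp add: adic_filtration_def)
  show "(\<Sum>i=0..j. fps_nth f i * fps_nth g (j - i)) \<in> ideal_power ring_of_type_algebra \<mm> (Suc m - j)"
  proof (rule P(5))
    fix i assume i: "i \<in> {0..j}"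
    show "fps_nth f i * fps_nth g (j - i) \<in> ideal_power ring_of_type_algebra \<mm> (Suc m - j)"
    proof (cases "i < j")
      case True
      then have "fps_nth f i \<in> ideal_power ring_of_type_algebra \<mm> (m - i)"
        using f j by (simp add: adic_filtration_def)
      then have "fps_nth f i \<in> ideal_power ring_of_type_algebra \<mm> (Suc m - j)"
        by (rule subsetD[OF ideal_power_decseq[OF I], rotated]) (use True in simp)
      then show ?thesis by (rule P(4))
    next
      case False
      then have [simp]: "i = j" using i by simp
      have "fps_nth f j \<in> ideal_power ring_of_type_algebra \<mm> (m - j)"
        using f by (cases "j < m") (simp_all add: adic_filtration_def)
      then have "fps_nth f j * fps_nth g 0 \<in> ideal_power ring_of_type_algebra \<mm> (Suc (m - j))"
        using ideal_prod.prod[OF _ g0, of _ _ "ring_of_type_algebra"] by simp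
      then show ?thesis using j by (simp add: Suc_diff_le del: ideal_power.simps)
    qed
  qed
qed

text \<open>For the harder inclusion, cut f at degree m: each of the finitely many lower monomials
  gets its missing factors from its coefficient, and the remainder is a multiple of (q-1)^m.\<close>

lemma R_ideal_power:
  fixes \<mm> :: "'w::comm_ring_1 set"
  assumes I: "ideal \<mm> ring_of_type_algebra"
  shows "ideal_power ring_of_type_algebra (R_ideal \<mm>) m = adic_filtration \<mm> m"
proof
  let ?P = "ideal_power ring_of_type_algebra (R_ideal \<mm>)"
  note F = ideal_type_algebraD[OF adic_filtration_ideal[OF I]]
  note R = ideal_type_algebraD[OF ideal_power_ideal[OF R_ideal_ideal]]
  have R_le: "R_ideal \<mm> \<subseteq> adic_filtration \<mm> 1"
    unfolding R_ideal_def
    by (rule ring.genideal_minimal[OF ring_from_type_algebra adic_filtration_ideal[OF I]])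
      (auto simp: adic_filtration_def qvar_def ideal_power_1[OF I, simplified] ideal_type_algebraD(1)[OF I])
  show "?P m \<subseteq> adic_filtration \<mm> m"
  proof (induction m)
    case 0
    then show ?case by (simp add: adic_filtration_def)
  next
    case (Suc m)
    show ?case
    proof
      fix x assume "x \<in> ?P (Suc m)"
      then have "x \<in> ideal_prod ring_of_type_algebra (?P m) (R_ideal \<mm>)" by simp
      then show "x \<in> adic_filtration \<mm> (Suc m)"
      proof (induction rule: ideal_prod.induct)
        case (prod i j)
        then show ?case using adic_filtration_mult[OF I, of i m j] Suc R_le by auto
      next
        case (sum s t)
        then show ?case by (simp add: F(2))
      qed
    qed
  qed
  have const: "fps_const w \<in> ?P r" if "w \<in> ideal_power ring_of_type_algebra \<mm> r" for w r
    using that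
  proof (induction r arbitrary: w)
    case (Suc r)
    from Suc.prems have "w \<in> ideal_prod ring_of_type_algebra (ideal_power ring_of_type_algebra \<mm> r) \<mm>" by simp
    then show ?case
    proof (induction rule: ideal_prod.induct)
      case (prod i j)
      from ideal_prod.prod[OF Suc.IH[OF prod(1)] R_ideal_generators(1)[OF prod(2)], of ring_of_type_algebra]
      show ?case by simp
    next
      case (sum s t)
      from R(2)[OF sum.IH] show ?case by (simp del: ideal_power.simps)
    qed
  qed simp
  have monom: "fps_const w * fps_X ^ j \<in> ?P (r + j)" if "w \<in> ideal_power ring_of_type_algebra \<mm> r" for w r j
  proof (induction j)
    case 0
    then show ?case using const[OF that] by simp
  next
    case (Suc j)
    from ideal_prod.prod[OF Suc R_ideal_generators(2), of ring_of_type_algebra] show ?case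
      by (simp add: mult_ac)
  qed
  show "adic_filtration \<mm> m \<subseteq> ?P m"
  proof
    fix f assume f: "f \<in> adic_filtration \<mm> m"
    have "fps_const (fps_nth f j) * fps_X ^ j \<in> ?P m" if "j < m" for j
      using monom[of "fps_nth f j" "m - j" j] f that by (simp add: adic_filtration_def)
    then have "fps_cutoff m f \<in> ?P m" unfolding fps_cutoff_eq_sum by (intro R(5)) auto
    moreover have "fps_shift m f * fps_X ^ m \<in> ?P m"
      using R(3)[OF monom[of 1 0 m], of "fps_shift m f"] by simp
    ultimately show "f \<in> ?P m" using R(2) fps_shift_cutoff[of m f] by metis
  qed
qed

lemma R_ideal_power_separated:
  fixes \<mm> :: "'w::comm_ring_1 set"
  assumes I: "ideal \<mm> ring_of_type_algebra"
    and sep: "(\<Inter>n. ideal_power ring_of_type_algebra \<mm> n) = {0}"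
  shows "(\<Inter>n. ideal_power ring_of_type_algebra (R_ideal \<mm>) n) = {0}"
proof -
  have "f = 0" if f: "\<And>m. f \<in> adic_filtration \<mm> m" for f
  proof (rule fps_ext)
    fix j
    have "fps_nth f j \<in> ideal_power ring_of_type_algebra \<mm> n" for n
    proof (cases n)
      case (Suc k)
      have "\<forall>i<j + n. fps_nth f i \<in> ideal_power ring_of_type_algebra \<mm> (j + n - i)"
        using f[of "j + n"] by (simp only: adic_filtration_def mem_Collect_eq)
      from this[rule_format, of j] show ?thesis using Suc by simp
    qed simp
    then show "fps_nth f j = fps_nth 0 j" using sep by auto
  qed
  moreover have "0 \<in> adic_filtration \<mm> m" for m
    by (rule ideal_type_algebraD(1)[OF adic_filtration_ideal[OF I]])
  ultimately show ?thesis unfolding R_ideal_power[OF I] by blast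
qed

lemma fps_cutoff_near:
  fixes \<mm> :: "'w::comm_ring_1 set"
  assumes I: "ideal \<mm> ring_of_type_algebra"
  shows "fps_cutoff n f \<in> ideal_power ring_of_type_algebra (R_ideal \<mm>) n +>\<^bsub>ring_of_type_algebra\<^esub> f"
proof -
  have "fps_cutoff n f - f \<in> adic_filtration \<mm> n"
    using ideal_type_algebraD(1)[OF ideal_power_ideal[OF I]] by (simp add: adic_filtration_def)
  then show ?thesis
    unfolding R_ideal_power[OF I] a_r_coset_def' by (auto intro!: bexI[of _ "fps_cutoff n f - f"])
qed

text \<open>Density of the W-span of the powers of q. \<open>E\<close> will be the set where two
  maps agree, once for linear maps and once for ring homomorphisms.\<close>

lemma fps_cutoff_in_span:
  assumes add: "\<And>f g. f \<in> E \<Longrightarrow> g \<in> E \<Longrightarrow> f + g \<in> E"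
    and gen: "\<And>w n. fps_const w * qvar ^ n \<in> E"
  shows "fps_cutoff M f \<in> E"
proof -
  \<comment> \<open>The extra factor q^n makes the induction work: X^(j+1) q^n = X^j q^(n+1) - X^j
    q^n with X = q - 1. The sign goes into w, as \<open>E\<close> is only known to be closed under
    sums.\<close>
  have monom: "fps_const w * fps_X ^ j * qvar ^ n \<in> E" for w j n
  proof (induction j arbitrary: w n)
    case 0
    then show ?case by (simp add: gen)
  next
    case (Suc j)
    have "fps_const w * fps_X ^ Suc j * qvar ^ n =
        fps_const w * fps_X ^ j * qvar ^ Suc n + fps_const (- w) * fps_X ^ j * qvar ^ n"
      by (simp add: qvar_def algebra_simps flip: fps_const_neg)
    then show ?case by (simp only: add Suc)
  qed
  have "0 \<in> E" using gen[of 0 0] by simp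
  then have "(\<Sum>j\<in>F. fps_const (fps_nth f j) * fps_X ^ j) \<in> E" for F
    using monom[of _ _ 0, simplified] by (induction F rule: infinite_finite_induct) (auto intro: add)
  then show ?thesis unfolding fps_cutoff_eq_sum .
qed


section \<open>Higher derivatives\<close>

lemma fps_mult_nth_eq_0:
  fixes f g :: "'a::comm_ring_1 fps"
  shows "(\<And>i. i \<le> n \<Longrightarrow> fps_nth g i = 0) \<Longrightarrow> fps_nth (f * g) n = 0"
  unfolding fps_mult_nth by (intro sum.neutral) auto

text \<open>\<open>taylor_coeff p s j k\<close> is the coefficient of \<open>e\<^sub>k\<close> in \<open>(q - 1 + s e\<^sub>1)\<^sup>j\<close>.\<close>

fun taylor_coeff :: "nat \<Rightarrow> 'w::comm_ring_1 fps \<Rightarrow> nat \<Rightarrow> nat \<Rightarrow> 'w fps"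
  where
    "taylor_coeff p s 0 k = (if k = 0 then 1 else 0)"
  | "taylor_coeff p s (Suc j) k =
      s * qnum (qvar ^ p) k * taylor_coeff p s j (k - 1) + ((qvar ^ p) ^ k * qvar - 1) * taylor_coeff p s j k"

text \<open>Divisibility by (q-1)^(j-k), stated on coefficients; it is what makes the sum defining
  \<open>higher_deriv\<close> finite.\<close>

lemma taylor_coeff_nth_eq_0:
  "N + k < j \<Longrightarrow> fps_nth (taylor_coeff p s j k) N = 0"
proof (induction j arbitrary: k N)
  case (Suc j)
  have "fps_nth (s * qnum (qvar ^ p) k * taylor_coeff p s j (k - 1)) N = 0"
  proof (cases k)
    case (Suc l)
    then show ?thesis using Suc.prems by (intro fps_mult_nth_eq_0 Suc.IH) auto
  qed simp
  moreover have "fps_nth (((qvar ^ p) ^ k * qvar - 1) * taylor_coeff p s j k) N = 0"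
    unfolding fps_mult_nth[of "(qvar ^ p) ^ k * qvar - 1"]
  proof (intro sum.neutral ballI)
    fix i assume i: "i \<in> {0..N}"
    have "fps_nth ((qvar ^ p) ^ k * qvar - 1 :: 'a fps) 0 = 0"
      by (simp add: qvar_def fps_power_zeroth_eq_one)
    moreover have "fps_nth (taylor_coeff p s j k) (N - i) = 0" if "0 < i"
      using that i Suc.prems by (intro Suc.IH) auto
    ultimately show "fps_nth ((qvar ^ p) ^ k * qvar - 1) i * fps_nth (taylor_coeff p s j k) (N - i) = 0"
      by (cases "i = 0") (simp_all only: mult_zero_left mult_zero_right neq0_conv)
  qed
  ultimately show ?case by simp
qed simp

text \<open>The (q-1)-adically continuous W-linear extension of (q-1)^j ->
  \<open>taylor_coeff p s j k\<close>. Terms with j > N + k do not reach coefficient N, whence the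
  range of summation.\<close>

definition higher_deriv :: "nat \<Rightarrow> 'w::comm_ring_1 fps \<Rightarrow> nat \<Rightarrow> 'w fps \<Rightarrow> 'w fps"
  where "higher_deriv p s k f = Abs_fps (\<lambda>N. \<Sum>j\<le>N + k. fps_nth f j * fps_nth (taylor_coeff p s j k) N)"

lemma higher_deriv_nth:
  "fps_nth (higher_deriv p s k f) N = (\<Sum>j\<le>N + k. fps_nth f j * fps_nth (taylor_coeff p s j k) N)"
  by (simp add: higher_deriv_def)

lemma higher_deriv_add: "higher_deriv p s k (f + g) = higher_deriv p s k f + higher_deriv p s k g"
  by (rule fps_ext) (simp add: higher_deriv_nth sum.distrib algebra_simps)

lemma higher_deriv_scale: "higher_deriv p s k (fps_const w * f) = fps_const w * higher_deriv p s k f"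
  by (rule fps_ext) (simp add: higher_deriv_nth sum_distrib_left mult.assoc)

lemma higher_deriv_X_power: "higher_deriv p s k (fps_X ^ j) = taylor_coeff p s j k"
proof (rule fps_ext)
  fix N
  have "fps_nth (higher_deriv p s k (fps_X ^ j)) N =
      (\<Sum>i\<le>N + k. if i = j then fps_nth (taylor_coeff p s j k) N else 0)"
    unfolding higher_deriv_nth by (intro sum.cong) auto
  then show "fps_nth (higher_deriv p s k (fps_X ^ j)) N = fps_nth (taylor_coeff p s j k) N"
    by (auto simp: taylor_coeff_nth_eq_0)
qed

lemma higher_deriv_X_power_mult_nth:
  "N + k < M \<Longrightarrow> fps_nth (higher_deriv p s k (fps_X ^ M * f)) N = 0"
  unfolding higher_deriv_nth by (intro sum.neutral) (auto simp: fps_X_power_mult_nth)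

text \<open>Density of polynomials for the \<open>(q - 1)\<close>-adic topology.\<close>

lemma additive_vanishing:
  fixes H :: "'w::comm_ring_1 fps \<Rightarrow> 'w fps"
  assumes add: "\<And>f g. H (f + g) = H f + H g"
    and monom: "\<And>w j. H (fps_const w * fps_X ^ j) = 0"
    and tail: "\<And>M N f. N + k < M \<Longrightarrow> fps_nth (H (fps_X ^ M * f)) N = 0"
  shows "H f = 0"
proof (rule fps_ext)
  fix N
  have H0: "H 0 = 0" using add[of 0 0] by simp
  have "H (\<Sum>j\<in>F. fps_const (fps_nth f j) * fps_X ^ j) = 0" for F
    by (induction F rule: infinite_finite_induct) (simp_all add: H0 add monom)
  then have "H (fps_cutoff M f) = 0" for M unfolding fps_cutoff_eq_sum .
  \<comment> \<open>The polynomial part contributes nothing. Coefficient N is then settled by a tail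
    of order N + k + 1, since \<open>H\<close> lowers the order by at most k.\<close>
  then have "H f = H (fps_X ^ M * fps_shift M f)" for M
    using add[of "fps_shift M f * fps_X ^ M" "fps_cutoff M f"] by (simp add: fps_shift_cutoff mult.commute)
  from this[of "Suc (N + k)"] tail[of N "Suc (N + k)"] show "fps_nth (H f) N = fps_nth 0 N" by simp
qed

text \<open>The recursion of \<open>taylor_coeff\<close> extended from monomials to power series:
  the difference of both sides is additive, kills monomials and lowers the order by at most
  k.\<close>

lemma higher_deriv_X_mult:
  "higher_deriv p s k (fps_X * f) = s * qnum (qvar ^ p) k * higher_deriv p s (k - 1) f
    + ((qvar ^ p) ^ k * qvar - 1) * higher_deriv p s k f"
proof -
  define H where "H f = higher_deriv p s k (fps_X * f) - (s * qnum (qvar ^ p) k * higher_deriv p s (k - 1) f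
    + ((qvar ^ p) ^ k * qvar - 1) * higher_deriv p s k f)" for f
  have "H f = 0"
  proof (rule additive_vanishing[where H = H and k = k])
    show "H (f + g) = H f + H g" for f g
      by (simp add: H_def higher_deriv_add algebra_simps)
    show "H (fps_const w * fps_X ^ j) = 0" for w j
    proof -
      have "fps_X * (fps_const w * fps_X ^ j) = fps_const w * fps_X ^ Suc j"
        by (metis mult.left_commute power_Suc)
      then have "higher_deriv p s k (fps_X * (fps_const w * fps_X ^ j)) = fps_const w * taylor_coeff p s (Suc j) k"
        by (simp only: higher_deriv_scale higher_deriv_X_power)
      then show ?thesis
        unfolding H_def by (simp add: higher_deriv_scale higher_deriv_X_power algebra_simps)
    qed
    show "fps_nth (H (fps_X ^ M * f)) N = 0" if "N + k < M" for M N f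
    proof -
      have "fps_nth (higher_deriv p s k (fps_X * (fps_X ^ M * f))) N = 0"
        using higher_deriv_X_power_mult_nth[of N k "Suc M" p s f] that by (simp add: mult.assoc)
      moreover have "fps_nth (a * higher_deriv p s (k - 1) (fps_X ^ M * f)) N = 0"
        "fps_nth (a * higher_deriv p s k (fps_X ^ M * f)) N = 0" for a
        using that by (auto intro!: fps_mult_nth_eq_0 higher_deriv_X_power_mult_nth)
      ultimately show ?thesis by (simp add: H_def)
    qed
  qed
  then show ?thesis by (simp add: H_def)
qed

lemma higher_deriv_qvar_power:
  "higher_deriv p s k (qvar ^ n) =
    s ^ k * qfact (qvar ^ p) k * qbinom (qvar ^ p) n k * qvar ^ (n - k)"
proof (induction n arbitrary: k)
  case 0
  then show ?case
    using higher_deriv_X_power[of p s k 0] by (cases k) (simp_all add: qfact_def)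
next
  case (Suc n)
  have "higher_deriv p s k (qvar ^ Suc n) = higher_deriv p s k (qvar ^ n) + higher_deriv p s k (fps_X * qvar ^ n)"
    by (simp add: qvar_def higher_deriv_add distrib_right)
  also have "\<dots> = s * qnum (qvar ^ p) k * higher_deriv p s (k - 1) (qvar ^ n)
      + (qvar ^ p) ^ k * qvar * higher_deriv p s k (qvar ^ n)"
    unfolding higher_deriv_X_mult by (simp add: algebra_simps)
  also have "\<dots> = s ^ k * qfact (qvar ^ p) k * qbinom (qvar ^ p) (Suc n) k * qvar ^ (Suc n - k)"
  proof (cases k)
    case 0
    then show ?thesis unfolding Suc by simp
  next
    case k: (Suc l)
    \<comment> \<open>For k > n the truncated exponent is wrong, but the binomial is zero.\<close>
    have e: "qvar * qbinom (qvar ^ p) n k * qvar ^ (n - k) = qbinom (qvar ^ p) n k * (qvar ^ (n - l) :: 'a fps)"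
    proof (cases "k \<le> n")
      case True
      then have "n - l = Suc (n - k)" using k by simp
      then show ?thesis by (simp add: mult_ac)
    qed (simp add: qbinom_eq_0)
    have "s * qnum (qvar ^ p) k * higher_deriv p s (k - 1) (qvar ^ n)
        + (qvar ^ p) ^ k * qvar * higher_deriv p s k (qvar ^ n) =
      s ^ k * qfact (qvar ^ p) k * (qbinom (qvar ^ p) n l * qvar ^ (n - l)
        + (qvar ^ p) ^ k * (qvar * qbinom (qvar ^ p) n k * qvar ^ (n - k)))"
      unfolding Suc k by (simp add: qfact_Suc algebra_simps)
    then show ?thesis
      unfolding e by (simp add: k algebra_simps)
  qed
  finally show ?case .
qed

text \<open>The place where the relation between s and c enters: (k)_Q s c = (k)_Q (Q - 1) = Q^k - 1
  turns q - 1 + s (k)_Q c q into the factor Q^k q - 1 of \<open>taylor_coeff\<close>.\<close>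

lemma higher_deriv_X_mult_seq:
  assumes "s * c = qvar ^ p - 1"
  shows "higher_deriv p s k (fps_X * f) =
    seq_mult (qvar ^ p) (c * qvar) (\<lambda>k. (if k = 0 then fps_X else 0) + (if k = 1 then s else 0))
      (\<lambda>k. higher_deriv p s k f) k"
proof -
  have "fps_X + s * (qnum (qvar ^ p) k * (c * qvar)) = (qvar - 1) + qnum (qvar ^ p) k * (s * c) * qvar"
    by (simp add: qvar_def mult_ac)
  also have "\<dots> = (qvar ^ p) ^ k * qvar - 1"
    unfolding assms qnum_mult_diff by (simp add: algebra_simps)
  finally have e: "(qvar ^ p) ^ k * qvar - 1 = fps_X + s * (qnum (qvar ^ p) k * (c * qvar))" ..
  show ?thesis
    unfolding seq_mult_add_left seq_mult_0_left seq_mult_1_left higher_deriv_X_mult e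
    by (cases k) (simp_all add: algebra_simps)
qed

lemma higher_deriv_mult:
  assumes sc: "s * c = qvar ^ p - 1"
  shows "higher_deriv p s N (f * g) =
    seq_mult (qvar ^ p) (c * qvar) (\<lambda>k. higher_deriv p s k f) (\<lambda>k. higher_deriv p s k g) N"
proof -
  let ?D = "\<lambda>f k. higher_deriv p s k f"
  let ?m = "seq_mult (qvar ^ p) (c * qvar)"
  \<comment> \<open>The Taylor sequence of q - 1, namely (q - 1) e_0 + s e_1.\<close>
  let ?V = "\<lambda>k. (if k = 0 then fps_X else 0) + (if k = 1 then s else 0)"
  have X: "?D (fps_X * f) = ?m ?V (?D f)" for f
    by (rule ext) (rule higher_deriv_X_mult_seq[OF sc])
  have monom: "?D (fps_const w * fps_X ^ j * g) N = ?m (?D (fps_const w * fps_X ^ j)) (?D g) N" for w j N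
  proof (induction j arbitrary: N)
    case 0
    have "?D (fps_const w) = (\<lambda>k. if k = 0 then fps_const w else 0)"
      using higher_deriv_scale[of p s _ w "fps_X ^ 0"] higher_deriv_X_power[of p s _ 0] by (auto simp: fun_eq_iff)
    then show ?case by (simp add: seq_mult_0_left higher_deriv_scale)
  next
    case (Suc j)
    have e: "fps_const w * fps_X ^ Suc j = fps_X * (fps_const w * fps_X ^ j)"
      by (metis mult.left_commute power_Suc)
    have "?D (fps_const w * fps_X ^ Suc j * g) N = ?m ?V (?D (fps_const w * fps_X ^ j * g)) N"
      using fun_cong[OF X[of "fps_const w * fps_X ^ j * g"], of N] unfolding e by (simp only: mult.assoc)
    also have "\<dots> = ?m ?V (?m (?D (fps_const w * fps_X ^ j)) (?D g)) N"
      by (simp only: Suc)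
    also have "\<dots> = ?m (?D (fps_const w * fps_X ^ Suc j)) (?D g) N"
      unfolding seq_mult_assoc[symmetric] e X ..
    finally show ?case .
  qed
  define H where "H f = ?D (f * g) N - ?m (?D f) (?D g) N" for f
  have "H f = 0"
  \<comment> \<open>Entry N of the product involves the derivatives of f of every order up to N,
    each lowering the order by at most N.\<close>
  proof (rule additive_vanishing[where H = H and k = N])
    show "H (f + h) = H f + H h" for f h
      by (simp add: H_def higher_deriv_add distrib_right seq_mult_add_left)
    show "H (fps_const w * fps_X ^ j) = 0" for w j
      using monom by (simp add: H_def)
    show "fps_nth (H (fps_X ^ M * f)) i = 0" if i: "i + N < M" for M i f
    proof -
      have "fps_nth (?D (fps_X ^ M * f * g) N) i = 0"
        using higher_deriv_X_power_mult_nth[OF i, of p s "f * g"] by (simp add: mult.assoc)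
      moreover have "fps_nth (a * ?D (fps_X ^ M * f) m) i = 0" if "m \<le> N" for m a
        using that i by (intro fps_mult_nth_eq_0 higher_deriv_X_power_mult_nth) auto
      then have "fps_nth (?D (fps_X ^ M * f) m * a * b) i = 0" if "m \<le> N" for m a b
        using that by (metis mult.assoc mult.commute)
      then have "fps_nth (?m (?D (fps_X ^ M * f)) (?D g) N) i = 0"
        by (simp add: seq_mult_def fps_sum_nth)
      ultimately show ?thesis by (simp add: H_def)
    qed
  qed
  then show ?thesis by (simp add: H_def)
qed

text \<open>Coefficient N of the derivative sees only coefficients j <= N + k of f, and for these m
  + k - j is at least m - N.\<close>

lemma higher_deriv_adic_filtration:
  fixes \<mm> :: "'w::comm_ring_1 set"
  assumes I: "ideal \<mm> ring_of_type_algebra" and f: "f \<in> adic_filtration \<mm> (m + k)"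
  shows "higher_deriv p s k f \<in> adic_filtration \<mm> m"
  unfolding adic_filtration_def higher_deriv_nth mem_Collect_eq
proof (intro allI impI ideal_type_algebraD(4,5)[OF ideal_power_ideal[OF I]])
  fix N j assume "N < m" "j \<in> {..N + k}"
  then have "j < m + k" "m - N \<le> m + k - j" by auto
  then show "fps_nth f j \<in> ideal_power ring_of_type_algebra \<mm> (m - N)"
    using f ideal_power_decseq[OF I, of "m - N" "m + k - j"] unfolding adic_filtration_def by blast
qed

lemma continuous_linear_higher_deriv:
  fixes \<mm> :: "'w::comm_ring_1 set"
  assumes I: "ideal \<mm> ring_of_type_algebra"
  shows "continuous_linear \<mm> (higher_deriv p s k)"
  unfolding continuous_linear_def
proof
  show "module_hom (\<lambda>w f. fps_const w * f) (\<lambda>w f. fps_const w * f) (higher_deriv p s k)"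
    by unfold_locales
      (simp_all add: distrib_left distrib_right mult.assoc higher_deriv_add higher_deriv_scale flip: fps_const_add fps_const_mult)
  have "higher_deriv p s k ` adic_filtration \<mm> (m + k) \<subseteq> adic_filtration \<mm> m" for m
    using higher_deriv_adic_filtration[OF I] by blast
  then show "continuous_map (R_topology \<mm>) (R_topology \<mm>) (higher_deriv p s k)"
    by (intro continuous_map_adicI R_ideal_ideal)
      (auto simp: higher_deriv_add R_ideal_power[OF I])
qed

lemma continuous_linear_eqI:
  fixes \<mm> :: "'w::comm_ring_1 set"
  assumes I: "ideal \<mm> ring_of_type_algebra"
    and sep: "(\<Inter>n. ideal_power ring_of_type_algebra \<mm> n) = {0}"
    and D: "continuous_linear \<mm> D" and D': "continuous_linear \<mm> D'"
    and eq: "\<And>n. D (qvar ^ n) = D' (qvar ^ n)"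
  shows "D = D'"
proof
  fix f
  interpret D: module_hom "\<lambda>w f. fps_const w * f" "\<lambda>w f. fps_const w * f" D
    using D by (simp add: continuous_linear_def)
  interpret D': module_hom "\<lambda>w f. fps_const w * f" "\<lambda>w f. fps_const w * f" D'
    using D' by (simp add: continuous_linear_def)
  have "fps_cutoff n f \<in> {f. D f = D' f}" for n
    by (rule fps_cutoff_in_span) (simp_all add: D.add D'.add D.scale D'.scale eq)
  then have "\<exists>y \<in> ideal_power ring_of_type_algebra (R_ideal \<mm>) n +>\<^bsub>ring_of_type_algebra\<^esub> f. D y = D' y" for n
    using fps_cutoff_near[OF I, of n f] by blast
  then show "D f = D' f"
    using D D' R_ideal_power_separated[OF I sep]
    by (intro continuous_map_adic_eqI[OF R_ideal_ideal R_ideal_ideal, of \<mm> \<mm> D D' f])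
      (simp_all add: continuous_linear_def)
qed

text \<open>Existence and uniqueness in one equivalence, so that the definite descriptions
  \<open>partial_xi\<close> and \<open>partial_omega\<close> can be evaluated, with s = 1 and s =
  (p)_q.\<close>

lemma higher_deriv_unique:
  fixes \<mm> :: "'w::comm_ring_1 set"
  assumes I: "ideal \<mm> ring_of_type_algebra"
    and sep: "(\<Inter>n. ideal_power ring_of_type_algebra \<mm> n) = {0}"
  shows "continuous_linear \<mm> D \<and>
      (\<forall>n. D (qvar ^ n) = s ^ k * qfact (qvar ^ p) k * qbinom (qvar ^ p) n k * qvar ^ (n - k)) \<longleftrightarrow>
    D = higher_deriv p s k"
proof
  assume D: "continuous_linear \<mm> D \<and>
      (\<forall>n. D (qvar ^ n) = s ^ k * qfact (qvar ^ p) k * qbinom (qvar ^ p) n k * qvar ^ (n - k))"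
  show "D = higher_deriv p s k"
    by (rule continuous_linear_eqI[OF I sep _ continuous_linear_higher_deriv[OF I]])
      (use D in \<open>simp_all add: higher_deriv_qvar_power\<close>)
qed (simp add: continuous_linear_higher_deriv[OF I] higher_deriv_qvar_power)


section \<open>Taylor maps\<close>

definition taylor_sum :: "nat \<Rightarrow> 'w::comm_ring_1 fps \<Rightarrow> nat \<Rightarrow> 'w fps \<Rightarrow> (nat \<Rightarrow>\<^sub>0 'w fps)"
  where "taylor_sum p s n \<alpha> = (\<Sum>k\<le>n. Poly_Mapping.single k (higher_deriv p s k \<alpha>))"

lemma lookup_taylor_sum:
  "Poly_Mapping.lookup (taylor_sum p s n \<alpha>) k = (if k \<le> n then higher_deriv p s k \<alpha> else 0)"
  by (auto simp: taylor_sum_def lookup_sum lookup_single when_def)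

lemma higher_deriv_const: "higher_deriv p s k (fps_const w) = (if k = 0 then fps_const w else 0)"
  using higher_deriv_scale[of p s k w "fps_X ^ 0"] higher_deriv_X_power[of p s k 0] by simp

lemma higher_deriv_1: "higher_deriv p s k 1 = (if k = 0 then 1 else 0)"
  using higher_deriv_const[of p s k 1] by simp

lemma higher_deriv_qvar:
  "higher_deriv p s k qvar = (if k = 0 then qvar else 0) + (if k = 1 then s else 0)"
proof -
  consider "k = 0" | "k = 1" | j where "k = Suc (Suc j)" by (metis One_nat_def not0_implies_Suc)
  then show ?thesis
    using higher_deriv_qvar_power[of p s k 1] by cases (simp_all add: qfact_def)
qed

text \<open>The product rule holds for untruncated sequences; cutting both factors at n does not
  affect entries N <= n of the product.\<close>

lemma taylor_sum_mult:
  assumes sc: "s * c = qvar ^ p - 1"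
  shows "truncation_class (twisted_algebra p c) n (taylor_sum p s n (\<alpha> * \<beta>)) =
    truncation_class (twisted_algebra p c) n (twisted_mult p c (taylor_sum p s n \<alpha>) (taylor_sum p s n \<beta>))"
  unfolding truncation_class_eq_iff
proof (intro allI impI)
  fix N assume "N \<le> n"
  then show "Poly_Mapping.lookup (taylor_sum p s n (\<alpha> * \<beta>)) N =
      Poly_Mapping.lookup (twisted_mult p c (taylor_sum p s n \<alpha>) (taylor_sum p s n \<beta>)) N"
    by (simp add: lookup_taylor_sum lookup_twisted_mult higher_deriv_mult[OF sc] seq_mult_def)
qed

lemma taylor_map_eq:
  fixes \<mm> :: "'w::comm_ring_1 set"
  assumes I: "ideal \<mm> ring_of_type_algebra"
    and sep: "(\<Inter>n. ideal_power ring_of_type_algebra \<mm> n) = {0}"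
    and sc: "s * c = qvar ^ p - 1"
  defines "A \<equiv> twisted_algebra p c"
  shows "taylor_map \<mm> A (Poly_Mapping.single 0 qvar + Poly_Mapping.single 1 s) n \<alpha> =
    truncation_class A n (taylor_sum p s n \<alpha>)"
proof -
  define B where "B = A Quot tail_ideal n"
  define J where "J = genideal B ((\<lambda>a. truncation_class A n (Poly_Mapping.single 0 a)) ` R_ideal \<mm>)"
  let ?P = "ideal_power ring_of_type_algebra (R_ideal \<mm>)"
  let ?v = "Poly_Mapping.single 0 qvar + Poly_Mapping.single 1 s"
  let ?\<theta> = "\<lambda>\<alpha>. truncation_class A n (taylor_sum p s n \<alpha>)"
  have top: "truncation_topology \<mm> A n = adic_topology B J"
    by (simp add: truncation_topology_def B_def J_def)
  have J: "ideal J B"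
    unfolding J_def B_def A_def by (rule ideal_power_truncation(1)[OF R_ideal_ideal])
  have J_power: "ideal_power B J m = truncation_class A n ` coeff_ideal n (?P m)" for m
    unfolding J_def B_def A_def by (rule ideal_power_truncation(2)[OF R_ideal_ideal])
  have carrier_B: "carrier B = range (truncation_class A n)"
    unfolding A_def B_def by (rule carrier_truncation)
  have add: "truncation_class A n f \<oplus>\<^bsub>B\<^esub> truncation_class A n g = truncation_class A n (f + g)" for f g
    unfolding A_def B_def by (rule truncation_class_add)
  have mult: "truncation_class A n f \<otimes>\<^bsub>B\<^esub> truncation_class A n g = truncation_class A n (twisted_mult p c f g)" for f g
    unfolding A_def B_def by (rule truncation_class_mult)
  have one: "truncation_class A n (Poly_Mapping.single 0 1) = \<one>\<^bsub>B\<^esub>"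
    unfolding A_def B_def by (rule truncation_class_one)
  have eq_iff: "truncation_class A n f = truncation_class A n g \<longleftrightarrow>
      (\<forall>k\<le>n. Poly_Mapping.lookup f k = Poly_Mapping.lookup g k)" for f g
    unfolding A_def by (rule truncation_class_eq_iff)
  have sum_add: "taylor_sum p s n (x + y) = taylor_sum p s n x + taylor_sum p s n y" for x y
    by (rule poly_mapping_eqI) (simp add: lookup_taylor_sum lookup_add higher_deriv_add)
  have hom: "?\<theta> \<in> ring_hom ring_of_type_algebra B"
  proof (rule ring_hom_memI)
    show "?\<theta> (x \<otimes>\<^bsub>ring_of_type_algebra\<^esub> y) = ?\<theta> x \<otimes>\<^bsub>B\<^esub> ?\<theta> y" for x y
      unfolding mult ring_of_type_algebra_simps unfolding A_def by (rule taylor_sum_mult[OF sc])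
    show "?\<theta> \<one>\<^bsub>ring_of_type_algebra\<^esub> = \<one>\<^bsub>B\<^esub>"
      unfolding one[symmetric] eq_iff
      by (simp add: lookup_taylor_sum lookup_single_fun higher_deriv_1 del: single_one)
  qed (simp_all add: carrier_B add sum_add)
  have const: "?\<theta> (fps_const w) = truncation_class A n (Poly_Mapping.single 0 (fps_const w))" for w
    unfolding eq_iff by (simp add: lookup_taylor_sum lookup_single_fun higher_deriv_const)
  have q: "?\<theta> qvar = truncation_class A n ?v"
    unfolding eq_iff by (simp add: lookup_taylor_sum lookup_add lookup_single_fun higher_deriv_qvar)
  have cont: "continuous_map (R_topology \<mm>) (adic_topology B J) ?\<theta>"
  proof (rule continuous_map_adicI[OF R_ideal_ideal J])
    fix m
    \<comment> \<open>The derivative of order k costs k steps of the filtration, and n bounds all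
      orders that occur.\<close>
    have "?\<theta> \<alpha> \<in> ideal_power B J m" if \<alpha>: "\<alpha> \<in> ?P (m + n)" for \<alpha>
    proof -
      have "higher_deriv p s k \<alpha> \<in> ?P m" if "k \<le> n" for k
        using higher_deriv_adic_filtration[OF I, of \<alpha> m k p s] \<alpha> that
          ideal_power_decseq[OF R_ideal_ideal[of \<mm>], of "m + k" "m + n"]
        unfolding R_ideal_power[OF I] by auto
      then show ?thesis
        unfolding J_power A_def truncation_class_mem_iff by (simp add: lookup_taylor_sum)
    qed
    then show "\<exists>N. ?\<theta> ` ?P N \<subseteq> ideal_power B J m" by blast
  qed (simp_all add: carrier_B add sum_add)
  have sep_B: "(\<Inter>m. ideal_power B J m) = {\<zero>\<^bsub>B\<^esub>}"
  proof -
    have "x = \<zero>\<^bsub>B\<^esub>" if x: "\<And>m. x \<in> ideal_power B J m" for x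
    proof -
      obtain f where f: "x = truncation_class A n f" using x[of 0] by (auto simp: carrier_B)
      have "\<forall>k\<le>n. Poly_Mapping.lookup f k \<in> ?P m" for m
        using x[of m] unfolding f J_power A_def truncation_class_mem_iff .
      then have "\<forall>k\<le>n. Poly_Mapping.lookup f k = 0"
        using R_ideal_power_separated[OF I sep] by blast
      then have "x = truncation_class A n 0" unfolding f eq_iff by simp
      then show ?thesis unfolding A_def B_def truncation_class_zero .
    qed
    moreover have "\<zero>\<^bsub>B\<^esub> \<in> ideal_power B J m" for m
      using ideal_power_ideal[OF J, of m] by (intro additive_subgroup.zero_closed ideal.axioms(1))
    ultimately show ?thesis by blast
  qed
  have "taylor_map \<mm> A ?v n = ?\<theta>"
    unfolding taylor_map_def top B_def[symmetric]
  proof (rule the_equality)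
    fix \<phi>
    assume \<phi>: "\<phi> \<in> ring_hom ring_of_type_algebra B \<and>
      (\<forall>w. \<phi> (fps_const w) = truncation_class A n (Poly_Mapping.single 0 (fps_const w))) \<and>
      continuous_map (R_topology \<mm>) (adic_topology B J) \<phi> \<and> \<phi> qvar = truncation_class A n ?v"
    then have \<phi>_hom: "\<phi> \<in> ring_hom ring_of_type_algebra B" by simp
    show "\<phi> = ?\<theta>"
    proof
      fix f
      \<comment> \<open>\<open>E\<close> contains W and q and is closed under sums and products, so
        it contains every polynomial in q - 1.\<close>
      define E where "E = {f. \<phi> f = ?\<theta> f}"
      have E_mult: "f * g \<in> E" if "f \<in> E" "g \<in> E" for f g
        using ring_hom_mult[OF \<phi>_hom, of f g] ring_hom_mult[OF hom, of f g] that by (simp add: E_def)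
      have E_add: "f + g \<in> E" if "f \<in> E" "g \<in> E" for f g
        using ring_hom_add[OF \<phi>_hom, of f g] ring_hom_add[OF hom, of f g] that by (simp add: E_def)
      have E_const: "fps_const w \<in> E" for w using \<phi> const by (simp add: E_def)
      have "qvar \<in> E" using \<phi> q by (simp add: E_def)
      then have "qvar ^ i \<in> E" for i
        using E_const[of 1] by (induction i) (simp_all add: E_mult)
      then have "fps_cutoff i f \<in> E" for i
        by (intro fps_cutoff_in_span E_add E_mult E_const)
      then have "\<exists>y \<in> ?P i +>\<^bsub>ring_of_type_algebra\<^esub> f. \<phi> y = ?\<theta> y" for i
        using fps_cutoff_near[OF I, of i f] unfolding E_def by blast
      then show "\<phi> f = ?\<theta> f"
        using \<phi> cont by (intro continuous_map_adic_eqI[OF R_ideal_ideal J sep_B, of \<mm> \<phi> ?\<theta> f]) simp_all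
    qed
  qed (use hom const cont q in simp)
  then show ?thesis by simp
qed

theorem proposition3p15:
  fixes p :: nat and \<mm> :: "'w::comm_ring_1 set"
  assumes "p > 0"
    and "complete_adic_ring ring_of_type_algebra \<mm>"
    and "finitely_generated_ideal ring_of_type_algebra \<mm>"
  shows "(\<forall>k. \<exists>!D. is_partial_xi p \<mm> k D) \<and>
    (\<forall>k. \<exists>!D. is_partial_omega p \<mm> k D) \<and>
    (\<forall>n \<alpha>. taylor_xi p \<mm> n \<alpha> =
      truncation_class (xi_algebra p) n
        (\<Sum>k\<le>n. Poly_Mapping.single k (partial_xi p \<mm> k \<alpha>))) \<and>
    (\<forall>n \<alpha>. taylor_omega p \<mm> n \<alpha> =
      truncation_class (omega_algebra p) n
        (\<Sum>k\<le>n. Poly_Mapping.single k (partial_omega p \<mm> k \<alpha>)))"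
proof -
  have I: "ideal \<mm> ring_of_type_algebra"
    and sep: "(\<Inter>n. ideal_power ring_of_type_algebra \<mm> n) = {0}"
    using assms(2) by (simp_all add: complete_adic_ring_def)
  have xi: "is_partial_xi p \<mm> k D \<longleftrightarrow> D = higher_deriv p 1 k" for k D
    using higher_deriv_unique[OF I sep, of D 1 k p] by (simp add: is_partial_xi_def)
  have omega: "is_partial_omega p \<mm> k D \<longleftrightarrow> D = higher_deriv p (qnum qvar p) k" for k D
    using higher_deriv_unique[OF I sep, of D "qnum qvar p" k p] by (simp add: is_partial_omega_def)
  have "partial_xi p \<mm> k = higher_deriv p 1 k" "partial_omega p \<mm> k = higher_deriv p (qnum qvar p) k" for k
    by (simp_all add: partial_xi_def partial_omega_def xi omega)
  then show ?thesis
    using taylor_map_eq[OF I sep, of 1 "qvar ^ p - 1" p]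
      taylor_map_eq[OF I sep, of "qnum qvar p" "qvar - 1" p, OF qnum_mult_diff]
    by (simp add: xi omega taylor_xi_def taylor_omega_def xi_algebra_def omega_algebra_def taylor_sum_def)
qed

end
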